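(* Let $\vec{\mathscr{D}}$ be the set of oriented planar link diagrams transverse to the axis $\{0\}\times\mathbb{R}$. The map $W\colon\vec{\mathscr{D}}\to\mathbb{Z}(A,B)$ defined by $$W(D):=\langle D\rangle\cdot(-A^{-3})^{\alpha(D)}\cdot(-B^{-3})^{\beta(D)}$$ is invariant under all Reidemeister moves respecting the axis, i.e. under R1, R2, R3 off the axis and S1, S2v, S2h, S2$\pm$, S3, S4 on the axis.
   Context: Diagrams: planar link diagrams in $\mathbb{R}^2$ transverse to the axis $\{0\}\times\mathbb{R}$ (every strand meeting the axis does so transversally; crossings may lie on the axis). Diagrams are identified if they differ by an orientation-preserving diffeomorphism of $\mathbb{R}^2$ fixing the axis setwise. For an oriented diagram $D$, $\alpha(D)$ is the sum of the signs of the crossings off the axis, and $\beta(D)$ is the sum of the signs of the crossings on the axis. Crossings on the axis: such a crossing has two ends on the left and two ends on the right. It is of type $X_o$ if the overstrand runs from upper left to lower right, of type $X_u$ if the overstrand runs from lower left to upper right. Its horizontal smoothing $h$ joins the upper left end to the upper right end and the lower left end to the lower right end; its vertical smoothing $v$ joins the two left ends to each other and the two right ends to each other (without meeting the axis). Bracket: $\langle D\rangle\in\mathbb{Z}(A,B)$ (rational functions) is defined on diagrams, forgetting orientations, by: (A) for a crossing off the axis, Kauffman's relation $\langle D\rangle=A\langle D_A\rangle+A^{-1}\langle D_B\rangle$, where $D_A$ is the smoothing joining the two regions swept out when the overstrand is turned counterclockwise to the understrand, and $D_B$ is the other smoothing; (B) for a crossing on the axis, $\langle X_o\rangle=B\langle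 h\rangle+B^{-1}\langle v\rangle$ and $\langle X_u\rangle=B^{-1}\langle h\rangle+B\langle v\rangle$; (C) for a collection $C$ of $n$ disjoint circles without crossings meeting the axis in $2m$ points, $\langle C\rangle=(-A^2-A^{-2})^{n-m}(-B^2-B^{-2})^{m-1}$. Reidemeister moves respecting the axis: the usual moves R1, R2, R3 inside a disk disjoint from the axis, and the following moves (and their inverses) inside a disk crossed by the axis. S1: insert on a strand crossing the axis once a kink whose crossing lies on the axis and whose loop crosses the axis once more (an $X_o$ or $X_u$ whose two upper, or two lower, ends are joined by an arc crossing the axis once). S2v: two consecutive crossings on the axis of opposite types $X_o,X_u$ between the same two strands, stacked vertically, are replaced by two vertical strands, one left and one right of the axis. S2h: for arcs $y=x^2+c$ and $y=-x^2$, the same arc being over at both crossings, change $c<0$ into $c>0$. S2$\pm$: viewing two horizontally running strands as a 2-braid, replace three consecutive crossings $\sigma^{\varepsilon}\sigma^{\delta}\sigma^{-\varepsilon}$ ($\varepsilon,\delta\in\{\pm1\}$; the first crossing left of the axis, the middle one on the axis, the last one right of the axis) by the single crossing $\sigma^{\delta}$ on the axis. S3: for lines $y=\pm ax$ ($a>0$) crossing on the axis in a crossing of either type and a horizontal line $y=c$ passing over both or under both of them, change $c>0$ into $c<0$. S4: for lines $y=c\pm ax$ and $y=c'\pm bx$ ($a,b>0$, $a\neq b$), each pair forming a crossing on the axis of arbitrary type, and both lines of the first pair passing over both lines of the second pair, change $c>c'$ into $c<c'$ keeping the types of the crossings on the axis. *)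

theory Defs
  imports
    "HOL-Computational_Algebra.Polynomial"
    "HOL-Computational_Algebra.Fraction_Field"
begin

section \<open>Planar link diagrams transverse to an axis\<close>

text \<open>
  A diagram transverse to the axis is recorded in Morse position with respect to the horizontal
  coordinate, as a triple \<open>(L, a, R)\<close>.  It is read from left to right, and the strands over a given
  abscissa are numbered \<open>0, 1, 2, \<dots>\<close> from bottom to top.  The word \<open>L\<close> lists the events in the open
  left half plane, the word \<open>R\<close> those in the open right half plane; the list \<open>a\<close> gives, from bottom
  to top, what lies on the axis: transverse points of a single strand, and crossings (each of which
  has two ends on the left and two on the right).

  Every diagram can be put into this form, and two triples represent the same diagram, up to an
  orientation-preserving diffeomorphism of the plane fixing the axis setwise, iff they are related by
  \<open>isotopic\<close> below: such a diffeomorphism either preserves both half planes, or does so after a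
  rotation by \<open>\<pi>\<close> about a point of the axis; in the former case it leaves \<open>a\<close> unchanged and acts on
  each of the two half-plane tangles by a planar isotopy, hence by a sequence of the elementary
  changes \<open>planar_local\<close> of Morse position.
\<close>

text \<open>
  A crossing has four ends (lower left, upper left, lower right, upper right).
  \<open>Xo\<close>: the overstrand runs from upper left to lower right.
  \<open>Xu\<close>: the overstrand runs from lower left to upper right.
  This is used for crossings on and off the axis alike.
\<close>

datatype crossing_type = Xo | Xu

fun opp :: "crossing_type \<Rightarrow> crossing_type" where
  "opp Xo = Xu"
| "opp Xu = Xo"

text \<open>
  \<open>Birth d i\<close>: a left-most point; two new strands appear at positions \<open>i\<close> and \<open>i + 1\<close>.
  \<open>Death d i\<close>: a right-most point; the strands at positions \<open>i\<close> and \<open>i + 1\<close> are joined.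
  \<open>Cross t i\<close>: a crossing between the strands at positions \<open>i\<close> and \<open>i + 1\<close>.
  The label \<open>d\<close> holds the orientation: \<^typ>\<open>bool\<close> for oriented diagrams, where it tells whether the
  strand at position \<open>i\<close> (the lower one) runs from left to right; \<^typ>\<open>unit\<close> for unoriented ones.
\<close>

datatype 'd event = Birth 'd nat | Death 'd nat | Cross crossing_type nat

datatype axis_event = AxisPoint | AxisCross crossing_type

type_synonym 'd diagram = "'d event list \<times> axis_event list \<times> 'd event list"

fun forget_orientation :: "bool diagram \<Rightarrow> unit diagram" where
  "forget_orientation (L, a, R) = (map (map_event (\<lambda>_. ())) L, a, map (map_event (\<lambda>_. ())) R)"

fun axis_ends :: "axis_event list \<Rightarrow> nat" where
  "axis_ends [] = 0"
| "axis_ends (AxisPoint # a) = axis_ends a + 1"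
| "axis_ends (AxisCross t # a) = axis_ends a + 2"


subsection \<open>Oriented diagrams\<close>

text \<open>
  The state over an abscissa is the list of the directions of its strands, from bottom to top;
  \<open>True\<close> means from left to right.  The result is \<open>None\<close> if an event does not fit.
\<close>

fun step :: "bool list \<Rightarrow> bool event \<Rightarrow> bool list option" where
  "step s (Birth d i) =
     (if i \<le> length s then Some (take i s @ [d, \<not> d] @ drop i s) else None)"
| "step s (Death d i) =
     (if i + 1 < length s \<and> s ! i = d \<and> s ! (i + 1) = (\<not> d)
      then Some (take i s @ drop (i + 2) s) else None)"
| "step s (Cross t i) =
     (if i + 1 < length s then Some (take i s @ [s ! (i + 1), s ! i] @ drop (i + 2) s) else None)"

fun run :: "bool list \<Rightarrow> bool event list \<Rightarrow> bool list option" where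
  "run s [] = Some s"
| "run s (e # w) = Option.bind (step s e) (\<lambda>s'. run s' w)"

fun axis_run :: "bool list \<Rightarrow> axis_event list \<Rightarrow> bool list option" where
  "axis_run [] [] = Some []"
| "axis_run (d # s) (AxisPoint # a) = map_option (\<lambda>s'. d # s') (axis_run s a)"
| "axis_run (d # d' # s) (AxisCross t # a) = map_option (\<lambda>s'. d' # d # s') (axis_run s a)"
| "axis_run _ _ = None"

fun flow :: "bool list \<Rightarrow> bool diagram \<Rightarrow> bool list option" where
  "flow s (L, a, R) = Option.bind (run s L) (\<lambda>s'. Option.bind (axis_run s' a) (\<lambda>s''. run s'' R))"

definition oriented_diagram :: "bool diagram \<Rightarrow> bool" where
  "oriented_diagram D \<longleftrightarrow> flow [] D = Some []"

text \<open>
  \<open>crossing_sign t d d'\<close>: sign of a crossing of type \<open>t\<close> whose lower left end has direction \<open>d\<close> and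
  whose upper left end has direction \<open>d'\<close>.
\<close>

definition crossing_sign :: "crossing_type \<Rightarrow> bool \<Rightarrow> bool \<Rightarrow> int" where
  "crossing_sign t d d' = (if (t = Xo) = (d = d') then 1 else - 1)"

fun event_sign :: "bool list \<Rightarrow> bool event \<Rightarrow> int" where
  "event_sign s (Cross t i) = crossing_sign t (s ! i) (s ! (i + 1))"
| "event_sign s _ = 0"

fun writhe :: "bool list \<Rightarrow> bool event list \<Rightarrow> int" where
  "writhe s [] = 0"
| "writhe s (e # w) = event_sign s e + writhe (the (step s e)) w"

fun axis_writhe :: "bool list \<Rightarrow> axis_event list \<Rightarrow> int" where
  "axis_writhe (d # s) (AxisPoint # a) = axis_writhe s a"
| "axis_writhe (d # d' # s) (AxisCross t # a) = crossing_sign t d d' + axis_writhe s a"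
| "axis_writhe _ _ = 0"

fun alpha :: "bool diagram \<Rightarrow> int" where
  "alpha (L, a, R) = writhe [] L + writhe (the (flow [] (L, a, []))) R"

fun beta :: "bool diagram \<Rightarrow> int" where
  "beta (L, a, R) = axis_writhe (the (run [] L)) a"


subsection \<open>Identification of diagrams\<close>

text \<open>
  \<open>far\<close> exchanges the abscissae of two events \<open>e\<close> and \<open>f\<close> that involve disjoint sets of strands,
  \<open>f\<close> lying above \<open>e\<close>.  The \<open>snake\<close> rules straighten an S-shaped strand.  In \<open>slide_birth\<close> and
  \<open>slide_death\<close> a strand crosses a fold of another strand on either side of the extremal point, which
  amounts to rotating the crossing.
\<close>

fun position :: "'d event \<Rightarrow> nat" where
  "position (Birth d i) = i"
| "position (Death d i) = i"
| "position (Cross t i) = i"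

fun move_to :: "nat \<Rightarrow> 'd event \<Rightarrow> 'd event" where
  "move_to j (Birth d i) = Birth d j"
| "move_to j (Death d i) = Death d j"
| "move_to j (Cross t i) = Cross t j"

fun ends_left :: "'d event \<Rightarrow> nat" where
  "ends_left (Birth d i) = 0"
| "ends_left (Death d i) = 2"
| "ends_left (Cross t i) = 2"

fun ends_right :: "'d event \<Rightarrow> nat" where
  "ends_right (Birth d i) = 2"
| "ends_right (Death d i) = 0"
| "ends_right (Cross t i) = 2"

inductive planar_local :: "'d event list \<Rightarrow> 'd event list \<Rightarrow> bool" where
  far: "position e + ends_left e \<le> position f \<Longrightarrow>
    planar_local [f, e] [e, move_to (position f - ends_left e + ends_right e) f]"
| snake1: "planar_local [Birth d i, Death d' (i + 1)] []"
| snake2: "planar_local [Birth d (i + 1), Death d' i] []"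
| slide_birth: "planar_local [Birth d i, Cross t (i + 1)] [Birth d (i + 1), Cross (opp t) i]"
| slide_death: "planar_local [Cross t i, Death d (i + 1)] [Cross (opp t) (i + 1), Death d i]"

text \<open>
  Replacement of \<open>x\<close> by \<open>y\<close> inside the left or the right word.  The conditions on \<open>t\<close> say that \<open>x\<close>
  and \<open>y\<close> induce the same orientation outside.
\<close>

inductive off_axis_change ::
  "(bool event list \<Rightarrow> bool event list \<Rightarrow> bool) \<Rightarrow> bool diagram \<Rightarrow> bool diagram \<Rightarrow> bool"
  for P where
  left: "P x y \<Longrightarrow> run [] u = Some s \<Longrightarrow> run s x = Some t \<Longrightarrow> run s y = Some t \<Longrightarrow>
    oriented_diagram (u @ x @ v, a, R) \<Longrightarrow> oriented_diagram (u @ y @ v, a, R) \<Longrightarrow>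
    off_axis_change P (u @ x @ v, a, R) (u @ y @ v, a, R)"
| right: "P x y \<Longrightarrow> flow [] (L, a, u) = Some s \<Longrightarrow> run s x = Some t \<Longrightarrow> run s y = Some t \<Longrightarrow>
    oriented_diagram (L, a, u @ x @ v) \<Longrightarrow> oriented_diagram (L, a, u @ y @ v) \<Longrightarrow>
    off_axis_change P (L, a, u @ x @ v) (L, a, u @ y @ v)"

text \<open>
  Rotation by \<open>\<pi>\<close> about a point of the axis.  The first argument of \<open>rotate_word\<close> is the number of
  strands at the left end of the word.  Neither the type of a crossing nor the orientation label of
  an extremal point changes: for the latter, the upper strand becomes the lower one and its direction
  is reversed.
\<close>

fun rotate_word :: "nat \<Rightarrow> 'd event list \<Rightarrow> 'd event list" where
  "rotate_word n [] = []"
| "rotate_word n (Birth d i # w) = rotate_word (n + 2) w @ [Death d (n - i)]"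
| "rotate_word n (Death d i # w) = rotate_word (n - 2) w @ [Birth d (n - 2 - i)]"
| "rotate_word n (Cross t i # w) = rotate_word n w @ [Cross t (n - 2 - i)]"

fun rotate_diagram :: "'d diagram \<Rightarrow> 'd diagram" where
  "rotate_diagram (L, a, R) = (rotate_word (axis_ends a) R, rev a, rotate_word 0 L)"

inductive isotopy_step :: "bool diagram \<Rightarrow> bool diagram \<Rightarrow> bool" where
  planar: "off_axis_change planar_local D D' \<Longrightarrow> isotopy_step D D'"
| rotation: "oriented_diagram D \<Longrightarrow> isotopy_step D (rotate_diagram D)"

definition isotopic :: "bool diagram \<Rightarrow> bool diagram \<Rightarrow> bool" where
  "isotopic = equivclp isotopy_step"


section \<open>The bracket\<close>

text \<open>The field of rational functions in \<open>A\<close> and \<open>B\<close> over the integers.\<close>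

type_synonym ratfun = "int poly poly fract"

definition A :: ratfun where "A = Fract [:[:0, 1:]:] 1"
definition B :: ratfun where "B = Fract [:0, 1:] 1"

text \<open>
  Circles of a crossingless word.  The point \<open>(t, i)\<close> is the strand at position \<open>i\<close> between the events
  number \<open>t - 1\<close> and \<open>t\<close>; points joined by a piece of the curve are identified.  \<open>carry e i\<close> is the
  position after \<open>e\<close> of the strand that is at position \<open>i\<close> before \<open>e\<close>.
\<close>

fun width :: "nat \<Rightarrow> 'd event list \<Rightarrow> nat" where
  "width n [] = n"
| "width n (e # w) = width (n - ends_left e + ends_right e) w"

fun carry :: "'d event \<Rightarrow> nat \<Rightarrow> nat option" where
  "carry (Birth d k) i = Some (if i < k then i else i + 2)"
| "carry (Death d k) i = (if i < k then Some i else if i < k + 2 then None else Some (i - 2))"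
| "carry (Cross t k) i = Some (if i = k then k + 1 else if i = k + 1 then k else i)"

definition points :: "'d event list \<Rightarrow> (nat \<times> nat) set" where
  "points w = {(t, i). t \<le> length w \<and> i < width 0 (take t w)}"

inductive joined :: "'d event list \<Rightarrow> nat \<times> nat \<Rightarrow> nat \<times> nat \<Rightarrow> bool" for w where
  strand: "t < length w \<Longrightarrow> i < width 0 (take t w) \<Longrightarrow> carry (w ! t) i = Some j \<Longrightarrow>
    joined w (t, i) (Suc t, j)"
| birth: "t < length w \<Longrightarrow> w ! t = Birth d i \<Longrightarrow> joined w (Suc t, i) (Suc t, i + 1)"
| death: "t < length w \<Longrightarrow> w ! t = Death d i \<Longrightarrow> joined w (t, i) (t, i + 1)"

definition circles :: "'d event list \<Rightarrow> nat" where
  "circles w = card (points w // {(p, q). equivclp (joined w) p q})"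

text \<open>
  The value on the diagram \<open>(L, replicate p AxisPoint, R)\<close> without crossings, that is, on \<open>n\<close> disjoint
  circles meeting the axis in \<open>p = 2 m\<close> points.
\<close>

definition circle_value :: "unit event list \<Rightarrow> nat \<Rightarrow> unit event list \<Rightarrow> ratfun" where
  "circle_value L p R =
     (let n = int (circles (L @ R)); m = int (p div 2)
      in (- (A ^ 2) - inverse A ^ 2) powi (n - m) * (- (B ^ 2) - inverse B ^ 2) powi (m - 1))"

text \<open>
  Kauffman's relation off the axis: \<open>resolve f\<close> extends \<open>f\<close> from crossingless words to all words.  For a crossing of type
  \<open>Xo\<close>, turning the overstrand counterclockwise sweeps the left and the right region, so that the
  smoothing with coefficient \<open>A\<close> is the horizontal one (two horizontal strands, no event); for \<open>Xu\<close> it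
  is the vertical one (a \<open>Death\<close> followed by a \<open>Birth\<close>).
\<close>

fun resolve :: "(unit event list \<Rightarrow> ratfun) \<Rightarrow> unit event list \<Rightarrow> ratfun" where
  "resolve f [] = f []"
| "resolve f (Birth d i # w) = resolve (\<lambda>w'. f (Birth d i # w')) w"
| "resolve f (Death d i # w) = resolve (\<lambda>w'. f (Death d i # w')) w"
| "resolve f (Cross Xo i # w) =
     A * resolve f w + inverse A * resolve (\<lambda>w'. f (Death () i # Birth () i # w')) w"
| "resolve f (Cross Xu i # w) =
     inverse A * resolve f w + A * resolve (\<lambda>w'. f (Death () i # Birth () i # w')) w"

text \<open>
  The relation on the axis.  \<open>axis_bracket p L a R\<close> is the bracket of \<open>(L, replicate p AxisPoint @ a, R)\<close>.  The
  horizontal smoothing of the lowest crossing on the axis leaves two points on the axis.  The vertical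
  one joins its two left ends just left of the axis and its two right ends just right of the axis.
\<close>

fun axis_bracket ::
  "nat \<Rightarrow> unit event list \<Rightarrow> axis_event list \<Rightarrow> unit event list \<Rightarrow> ratfun" where
  "axis_bracket p L [] R = resolve (\<lambda>L'. resolve (\<lambda>R'. circle_value L' p R') R) L"
| "axis_bracket p L (AxisPoint # a) R = axis_bracket (p + 1) L a R"
| "axis_bracket p L (AxisCross Xo # a) R =
     B * axis_bracket (p + 2) L a R
     + inverse B * axis_bracket p (L @ [Death () p]) a (Birth () p # R)"
| "axis_bracket p L (AxisCross Xu # a) R =
     inverse B * axis_bracket (p + 2) L a R
     + B * axis_bracket p (L @ [Death () p]) a (Birth () p # R)"

fun bracket :: "unit diagram \<Rightarrow> ratfun" where
  "bracket (L, a, R) = axis_bracket 0 L a R"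

text \<open>The defining relations, as equations between brackets of diagrams.\<close>

fun coeff_h :: "ratfun \<Rightarrow> crossing_type \<Rightarrow> ratfun" where
  "coeff_h c Xo = c"
| "coeff_h c Xu = inverse c"

fun coeff_v :: "ratfun \<Rightarrow> crossing_type \<Rightarrow> ratfun" where
  "coeff_v c Xo = inverse c"
| "coeff_v c Xu = c"

lemma resolve_linear:
  "resolve (\<lambda>w. c * f w + d * g w) w = c * resolve f w + d * resolve g w"
proof (induction w arbitrary: f g)
  case (Cons e w)
  show ?case
  proof (cases e)
    case (Cross t i)
    then show ?thesis by (cases t) (simp_all add: Cons.IH algebra_simps)
  qed (simp_all add: Cons.IH)
qed simp

lemma resolve_cross:
  "resolve f (u @ Cross t i # v) =
     coeff_h A t * resolve f (u @ v) + coeff_v A t * resolve f (u @ Death () i # Birth () i # v)"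
proof (induction u arbitrary: f)
  case Nil
  show ?case by (cases t) simp_all
next
  case (Cons e u)
  show ?case
  proof (cases e)
    case (Cross t' j)
    then show ?thesis by (cases t') (simp_all add: Cons.IH algebra_simps)
  qed (simp_all add: Cons.IH)
qed

lemma axis_bracket_cross_left:
  "axis_bracket p (u @ Cross t i # v) a R =
     coeff_h A t * axis_bracket p (u @ v) a R
     + coeff_v A t * axis_bracket p (u @ Death () i # Birth () i # v) a R"
proof (induction a arbitrary: p v R)
  case Nil
  show ?case by (simp add: resolve_cross)
next
  case (Cons e a)
  show ?case
  proof (cases e)
    case (AxisCross t')
    then show ?thesis by (cases t') (simp_all add: Cons.IH algebra_simps)
  qed (simp add: Cons.IH)
qed

lemma axis_bracket_cross_right:
  "axis_bracket p L a (u @ Cross t i # v) =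
     coeff_h A t * axis_bracket p L a (u @ v)
     + coeff_v A t * axis_bracket p L a (u @ Death () i # Birth () i # v)"
proof (induction a arbitrary: p L u)
  case Nil
  show ?case by (simp add: resolve_cross resolve_linear)
next
  case (Cons e a)
  show ?case
  proof (cases e)
    case (AxisCross t')
    then show ?thesis
      using Cons.IH[of _ _ "Birth () p # u"] Cons.IH[of _ _ u]
      by (cases t') (simp_all add: algebra_simps)
  qed (simp add: Cons.IH)
qed

lemma axis_bracket_replicate:
  "axis_bracket p L (replicate k AxisPoint @ a) R = axis_bracket (p + k) L a R"
  by (induction k arbitrary: p) simp_all

lemma bracket_skein_left:
  "bracket (u @ Cross t i # v, a, R) =
     coeff_h A t * bracket (u @ v, a, R)
     + coeff_v A t * bracket (u @ [Death () i, Birth () i] @ v, a, R)"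
  by (simp add: axis_bracket_cross_left)

lemma bracket_skein_right:
  "bracket (L, a, u @ Cross t i # v) =
     coeff_h A t * bracket (L, a, u @ v)
     + coeff_v A t * bracket (L, a, u @ [Death () i, Birth () i] @ v)"
  by (simp add: axis_bracket_cross_right)

lemma bracket_skein_axis:
  "bracket (L, replicate k AxisPoint @ AxisCross t # a, R) =
     coeff_h B t * bracket (L, replicate k AxisPoint @ [AxisPoint, AxisPoint] @ a, R)
     + coeff_v B t * bracket (L @ [Death () k], replicate k AxisPoint @ a, [Birth () k] @ R)"
  by (cases t) (simp_all add: axis_bracket_replicate)

lemma resolve_crossingless:
  "(\<And>t i. Cross t i \<notin> set w) \<Longrightarrow> resolve f w = f w"
proof (induction w arbitrary: f)
  case (Cons e w)
  have w: "Cross t i \<notin> set w" for t i using Cons.prems[of t i] by simp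
  show ?case
  proof (cases e)
    case (Cross t i)
    then show ?thesis using Cons.prems[of t i] by simp
  qed (simp_all add: Cons.IH[OF w])
qed simp

lemma bracket_circles:
  assumes "\<And>t i. Cross t i \<notin> set L" "\<And>t i. Cross t i \<notin> set R"
  shows "bracket (L, replicate (2 * m) AxisPoint, R) =
    (- (A ^ 2) - inverse A ^ 2) powi (int (circles (L @ R)) - int m)
    * (- (B ^ 2) - inverse B ^ 2) powi (int m - 1)"
  using axis_bracket_replicate[of 0 L "2 * m" "[]" R]
  by (simp add: resolve_crossingless[OF assms(1)] resolve_crossingless[OF assms(2)]
      circle_value_def Let_def)

definition W :: "bool diagram \<Rightarrow> ratfun" where
  "W D = bracket (forget_orientation D)
     * (- (inverse A ^ 3)) powi alpha D * (- (inverse B ^ 3)) powi beta D"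


section \<open>Reidemeister moves respecting the axis\<close>

text \<open>
  The moves in a disk disjoint from the axis, up to planar isotopy of the disk.  With \<open>R1_above\<close> and
  \<open>R1_below\<close>, \<open>t\<close> arbitrary, all four kinds of kinks occur.  In \<open>R3\<close> let 1, 2, 3 be the strands from
  bottom to top on the left; \<open>a\<close>, \<open>b\<close>, \<open>c\<close> are the types of the crossings 1-2, 1-3, 2-3.  The
  condition says that the relation ``over'' between the three strands is not cyclic.
\<close>

inductive off_axis_local :: "'d event list \<Rightarrow> 'd event list \<Rightarrow> bool" where
  R1_above: "off_axis_local [Birth d (i + 1), Cross t i, Death d' (i + 1)] []"
| R1_below: "off_axis_local [Birth d i, Cross t (i + 1), Death d' i] []"
| R2: "off_axis_local [Cross t i, Cross (opp t) i] []"
| R3: "\<not> (a = c \<and> b \<noteq> a) \<Longrightarrow>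
    off_axis_local [Cross a i, Cross b (i + 1), Cross c i] [Cross c (i + 1), Cross b i, Cross a (i + 1)]"

text \<open>
  The moves in a disk crossed by the axis, as replacements of \<open>(x, p, y)\<close>, where \<open>p\<close> lies on the axis,
  \<open>x\<close> immediately to its left, and \<open>y\<close> immediately to its right; \<open>i\<close> is the position of the lowest
  strand in the disk.  In \<open>S2h\<close>, \<open>S2pm\<close> and \<open>S3\<close>, the two values of \<open>t\<close> cover both
  possibilities over/under.  In \<open>S4\<close>, \<open>r\<close> is the type of the crossing of the over-pair \<open>y = c \<plusminus> a x\<close> and \<open>s\<close>
  that of the under-pair \<open>y = c' \<plusminus> b x\<close>, with \<open>c > c'\<close> before and \<open>c < c'\<close> after the move;
  \<open>S4_steep\<close> is the case \<open>a > b\<close>, and \<open>S4_flat\<close> the case \<open>a < b\<close>.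
\<close>

inductive axis_local :: "nat \<Rightarrow> 'd diagram \<Rightarrow> 'd diagram \<Rightarrow> bool" for i where
  S1_upper: "axis_local i
    ([Birth d (i + 1)], [AxisCross s, AxisPoint], [Death d' (i + 1)])
    ([], [AxisPoint], [])"
| S1_lower: "axis_local i
    ([Birth d i], [AxisPoint, AxisCross s], [Death d' i])
    ([], [AxisPoint], [])"
| S2v: "axis_local i
    ([Birth d (i + 1)], [AxisCross s, AxisCross (opp s)], [Death d' (i + 1)])
    ([Death e i], [], [Birth e' i])"
| S2h: "axis_local i
    ([Cross t i], [AxisPoint, AxisPoint], [Cross (opp t) i])
    ([], [AxisPoint, AxisPoint], [])"
| S2pm: "axis_local i
    ([Cross t i], [AxisCross s], [Cross (opp t) i])
    ([], [AxisCross s], [])"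
| S3: "axis_local i
    ([Cross t (i + 1)], [AxisCross s, AxisPoint], [Cross (opp t) (i + 1)])
    ([Cross (opp t) i], [AxisPoint, AxisCross s], [Cross t i])"
| S4_steep: "axis_local i
    ([Cross Xu i, Cross Xu (i + 1)], [AxisCross s, AxisCross r], [Cross Xo (i + 1), Cross Xo i])
    ([Cross Xo (i + 2), Cross Xo (i + 1)], [AxisCross r, AxisCross s], [Cross Xu (i + 1), Cross Xu (i + 2)])"
| S4_flat: "axis_local i
    ([Cross Xu (i + 2), Cross Xu (i + 1)], [AxisCross s, AxisCross r], [Cross Xo (i + 1), Cross Xo (i + 2)])
    ([Cross Xo i, Cross Xo (i + 1)], [AxisCross r, AxisCross s], [Cross Xu (i + 1), Cross Xu i])"

text \<open>As before, the conditions on \<open>t\<close> express that the orientations agree outside the disk.\<close>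

inductive reidemeister :: "bool diagram \<Rightarrow> bool diagram \<Rightarrow> bool" where
  off_axis: "off_axis_change off_axis_local D D' \<Longrightarrow> reidemeister D D'"
| on_axis: "axis_local (axis_ends a1) (x, p, y) (x', p', y') \<Longrightarrow>
    run [] u = Some s \<Longrightarrow>
    flow s (x, a1 @ p @ a2, y) = Some t \<Longrightarrow> flow s (x', a1 @ p' @ a2, y') = Some t \<Longrightarrow>
    oriented_diagram (u @ x, a1 @ p @ a2, y @ v) \<Longrightarrow>
    oriented_diagram (u @ x', a1 @ p' @ a2, y' @ v) \<Longrightarrow>
    reidemeister (u @ x, a1 @ p @ a2, y @ v) (u @ x', a1 @ p' @ a2, y' @ v)"
| inverse: "reidemeister D D' \<Longrightarrow> reidemeister D' D"

end

theory Submission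
  imports Defs
begin

text \<open>
  A word acts from the left on the ways in which its strands may be connected further to the left: a
  birth adds a new class of two strands, a death merges two classes and contributes the factor
  \<open>- A\<^sup>2 - A\<^sup>-\<^sup>2\<close> if they are already equal, and a crossing acts through Kauffman's relation.  Read
  as operators on functions of the connectivity, births and deaths satisfy the Temperley-Lieb
  relations, and so the moves off the axis become identities in the Temperley-Lieb algebra.  On the
  axis, transporting a birth or a death through two neighbouring axis points costs the factor
  \<open>(- B\<^sup>2 - B\<^sup>-\<^sup>2) / (- A\<^sup>2 - A\<^sup>-\<^sup>2)\<close>; after the crossings on the axis are smoothed, this reduces the moves
  on the axis to those off the axis and to the value of a circle.  Invariance under the rotation
  by \<open>\<pi>\<close> is proved by smoothing all crossings and carrying circles over to the rotated word.
\<close>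

section \<open>Connectivity of strands\<close>

text \<open>Two features of the bracket resist local arguments: the number of circles is global, and
  the factor of the axis depends on the total number of points on it. Reading from left to right
  localises the first: a functional stands for everything to the right of an abscissa, a
  connectivity for everything to its left, and each circle is charged to the death that closes it.
  For the second, a birth and a death each pay the same price for passing two plain axis points, so
  a crossing passes them for free. This turns S2h into R2; S2pm, S3 and S4 follow by smoothing the
  crossings on the axis and sliding strands across the resulting folds, while S1 and S2v are the
  computations of R1 and R2 with \<open>B\<close> in place of \<open>A\<close>. The price of this
  approach is that it is not symmetric: a half turn is invisible on operators and has to be traced
  through the count of circles itself.\<close>

text \<open>
  The stack of strands is infinite upwards, so that births and deaths act everywhere and the relations
  between them need no bounds.
\<close>

typedef linking = "{r :: nat \<Rightarrow> nat \<Rightarrow> bool. equivp r}"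
  morphisms linked Linking
  by (auto intro: identity_equivp)

setup_lifting type_definition_linking

lift_definition unlinked :: linking is "(=)"
  by (rule identity_equivp)

text \<open>\<open>skip i\<close> names, in the numbering before a death at \<open>i\<close>, the
  strands that survive it; \<open>unskip i\<close> goes back. The values of \<open>unskip i\<close>
  at \<open>i\<close> and \<open>i + 1\<close> are arbitrary, and \<open>birth_link\<close> tests
  for these two positions first.\<close>

definition skip :: "nat \<Rightarrow> nat \<Rightarrow> nat" where
  "skip i j = (if j < i then j else j + 2)"

definition unskip :: "nat \<Rightarrow> nat \<Rightarrow> nat" where
  "unskip i j = (if j < i then j else j - 2)"

lift_definition birth_link :: "nat \<Rightarrow> linking \<Rightarrow> linking" is
  "\<lambda>i r j k. if j = i \<or> j = i + 1 then k = i \<or> k = i + 1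
     else k \<noteq> i \<and> k \<noteq> i + 1 \<and> r (unskip i j) (unskip i k)"
  by (intro equivpI reflpI sympI transpI)
    (auto split: if_splits dest: equivp_symp equivp_transp intro: equivp_reflp)

text \<open>This is the equivalence relation generated by \<open>r\<close> and the pair
  \<open>i\<close>, \<open>i + 1\<close>, restricted to the surviving strands: with a single new
  pair, a chain needs it at most once, in one of its two directions.\<close>

lift_definition death_link :: "nat \<Rightarrow> linking \<Rightarrow> linking" is
  "\<lambda>i r j k. r (skip i j) (skip i k) \<or> r (skip i j) i \<and> r (i + 1) (skip i k)
     \<or> r (skip i j) (i + 1) \<and> r i (skip i k)"
  by (intro equivpI reflpI sympI transpI)
    (blast dest: equivp_symp equivp_transp intro: equivp_reflp)+

lemma linked_equivp: "equivp (linked r)"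
  using linked[of r] by simp

lemma linked_refl [simp]: "linked r i i"
  using linked_equivp by (rule equivp_reflp)

text \<open>An equivalence relation is the kernel of the map sending a strand to its class. Proofs
  about merging classes thus become case distinctions on equalities of labels.\<close>

lemma linked_label: "linked r i j \<longleftrightarrow> linked r i = linked r j"
  using linked_equivp[of r] unfolding equivp_def by blast

lemma linking_eqI: "(\<And>i j. linked r i j = linked s i j) \<Longrightarrow> r = s"
  by (simp add: linked_inject[symmetric] fun_eq_iff)

text \<open>With positions between or above the two folds written as sums, the simplifier evaluates
  \<open>skip\<close> and \<open>unskip\<close> without truncated subtraction.\<close>

lemma zones_birth_birth:
  fixes j p k :: nat
  obtains "j < p" | "j = p" | "j = Suc p" | a where "j = p + a + 2" "a < k"
    | "j = p + k + 2" | "j = p + k + 3" | a where "j = p + k + 4 + a"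
proof -
  consider "j < p" | "j = p" | "j = Suc p" | "p + 2 \<le> j" "j < p + k + 2"
    | "j = p + k + 2" | "j = p + k + 3" | "p + k + 4 \<le> j"
    by linarith
  then show thesis
    using that(1-3,5,6) that(4)[of "j - p - 2"] that(7)[of "j - p - k - 4"] by cases auto
qed

lemma zones_birth_death:
  fixes j p k :: nat
  obtains "j < p" | a where "j = p + a" "a < k"
    | "j = p + k" | "j = p + k + 1" | a where "j = p + k + 2 + a"
proof -
  consider "j < p" | "p \<le> j" "j < p + k" | "j = p + k" | "j = p + k + 1" | "p + k + 2 \<le> j"
    by linarith
  then show thesis
    using that(1,3,4) that(2)[of "j - p"] that(5)[of "j - p - k - 2"] by cases auto
qed

lemmas link_simps = birth_link.rep_eq death_link.rep_eq unskip_def skip_def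

lemma birth_birth:
  "birth_link p (birth_link (p + k) r) = birth_link (p + k + 2) (birth_link p r)"
proof (rule linking_eqI)
  fix i j
  show "linked (birth_link p (birth_link (p + k) r)) i j =
    linked (birth_link (p + k + 2) (birth_link p r)) i j"
    by (cases i rule: zones_birth_birth[where p = p and k = k]; cases j rule: zones_birth_birth[where p = p and k = k])
      (simp_all add: link_simps eval_nat_numeral)
qed

lemma death_birth:
  "birth_link p (death_link (p + k) r) = death_link (p + k + 2) (birth_link p r)"
proof (rule linking_eqI)
  fix i j
  show "linked (birth_link p (death_link (p + k) r)) i j =
    linked (death_link (p + k + 2) (birth_link p r)) i j"
    by (cases i rule: zones_birth_birth[where p = p and k = k]; cases j rule: zones_birth_birth[where p = p and k = k])
      (simp_all add: link_simps eval_nat_numeral)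
qed

lemma birth_death:
  "death_link p (birth_link (p + k + 2) r) = birth_link (p + k) (death_link p r)"
proof (rule linking_eqI)
  fix i j
  show "linked (death_link p (birth_link (p + k + 2) r)) i j =
    linked (birth_link (p + k) (death_link p r)) i j"
    by (cases i rule: zones_birth_death[where p = p and k = k]; cases j rule: zones_birth_death[where p = p and k = k])
      (simp_all add: link_simps eval_nat_numeral)
qed

text \<open>\<open>E a b\<close> is equality after \<open>a\<close> and \<open>b\<close> have been
  identified. Both sides describe equality after identifying \<open>a\<close> with \<open>b\<close>
  and \<open>c\<close> with \<open>d\<close>, in opposite orders.\<close>

lemma merge_commute:
  fixes a b c d x y :: 'a
  defines "E \<equiv> \<lambda>a b x y. x = y \<or> x = a \<and> b = y \<or> x = b \<and> a = y"
  shows "E c d x y \<or> E c d x a \<and> E c d b y \<or> E c d x b \<and> E c d a y \<longleftrightarrow>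
    E a b x y \<or> E a b x c \<and> E a b d y \<or> E a b x d \<and> E a b c y"
  unfolding E_def
  by (cases "x = y"; cases "x = a"; cases "x = b"; cases "x = c"; cases "x = d") auto

lemma death_death:
  "death_link p (death_link (p + k + 2) r) = death_link (p + k) (death_link p r)"
proof (rule linking_eqI)
  fix i j
  have skip: "skip (p + k + 2) (skip p m) = skip p (skip (p + k) m)" for m
    by (auto simp: skip_def)
  have pts: "skip (p + k + 2) p = p" "skip (p + k + 2) (p + 1) = p + 1"
    "skip p (p + k) = p + k + 2" "skip p (p + k + 1) = p + k + 2 + 1"
    by (auto simp: skip_def)
  obtain f :: "nat \<Rightarrow> nat \<Rightarrow> bool" where f: "linked r x y \<longleftrightarrow> f x = f y" for x y
    by (rule that[of "linked r"]) (rule linked_label)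
  show "linked (death_link p (death_link (p + k + 2) r)) i j =
    linked (death_link (p + k) (death_link p r)) i j"
    unfolding death_link.rep_eq skip pts f
    by (rule merge_commute)
qed

lemma death_birth_same: "death_link i (birth_link i r) = r"
  by (rule linking_eqI) (simp add: link_simps)

lemma zones_snake:
  fixes i j :: nat
  obtains "j < i" | "j = i" | a where "j = i + 1 + a"
  using that(1,2) that(3)[of "j - i - 1"] by fastforce

lemma death_Suc_birth: "death_link (Suc i) (birth_link i r) = r"
proof (rule linking_eqI)
  fix j k
  show "linked (death_link (Suc i) (birth_link i r)) j k = linked r j k"
    by (cases j rule: zones_snake[where i = i]; cases k rule: zones_snake[where i = i])
      (simp_all add: link_simps eval_nat_numeral)
qed

lemma death_birth_Suc: "death_link i (birth_link (Suc i) r) = r"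
proof (rule linking_eqI)
  fix j k
  show "linked (death_link i (birth_link (Suc i) r)) j k = linked r j k"
    by (cases j rule: zones_snake[where i = i]; cases k rule: zones_snake[where i = i])
      (simp_all add: link_simps eval_nat_numeral)
qed

section \<open>Temperley-Lieb relations\<close>

definition loop_A :: ratfun where "loop_A = - (A ^ 2) - inverse A ^ 2"
definition loop_B :: ratfun where "loop_B = - (B ^ 2) - inverse B ^ 2"

lemma A_nonzero [simp]: "A \<noteq> 0"
  by (simp add: A_def Zero_fract_def eq_fract)

lemma B_nonzero [simp]: "B \<noteq> 0"
  by (simp add: B_def Zero_fract_def eq_fract)

lemma fract_power: "Fract a 1 ^ n = Fract (a ^ n) 1"
  by (induction n) (simp_all add: One_fract_def)

text \<open>Multiplication by \<open>- (A ^ 2)\<close> turns the equation into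
  \<open>A ^ 4 + 1 = 0\<close>, which fails for polynomials. Nonvanishing gives sense to the
  negative powers of a circle's value and to \<open>loop_B / loop_A\<close>.\<close>

lemma loop_A_nonzero [simp]: "loop_A \<noteq> 0"
proof
  assume "loop_A = 0"
  then have "A ^ 4 + 1 = 0"
    by (simp add: loop_A_def inverse_eq_divide field_simps eval_nat_numeral)
  then have "[:[:0, 1:]:] ^ 4 + 1 = (0 :: int poly poly)"
    by (simp add: A_def fract_power One_fract_def Zero_fract_def eq_fract)
  then show False
    by (simp add: eval_nat_numeral one_pCons)
qed

lemma loop_B_nonzero [simp]: "loop_B \<noteq> 0"
proof
  assume "loop_B = 0"
  then have "B ^ 4 + 1 = 0"
    by (simp add: loop_B_def inverse_eq_divide field_simps eval_nat_numeral)
  then have "[:0, 1:] ^ 4 + 1 = (0 :: int poly poly)"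
    by (simp add: B_def fract_power One_fract_def Zero_fract_def eq_fract)
  then show False
    by (simp add: eval_nat_numeral one_pCons)
qed

type_synonym functional = "linking \<Rightarrow> ratfun"

text \<open>Operators act by precomposition: \<open>r\<close> is the connectivity to the left of the
  event and \<open>f\<close> evaluates what lies to its right, so the first event of a word is the
  outermost operator.\<close>

definition birth_op :: "nat \<Rightarrow> functional \<Rightarrow> functional" where
  "birth_op i f r = f (birth_link i r)"

definition death_op :: "nat \<Rightarrow> functional \<Rightarrow> functional" where
  "death_op i f r = (if linked r i (i + 1) then loop_A else 1) * f (death_link i r)"

lemma birth_op_linear:
  "birth_op i (\<lambda>r. f r + g r) = (\<lambda>r. birth_op i f r + birth_op i g r)"
  "birth_op i (\<lambda>r. c * f r) = (\<lambda>r. c * birth_op i f r)"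
  by (simp_all add: birth_op_def fun_eq_iff)

lemma death_op_linear:
  "death_op i (\<lambda>r. f r + g r) = (\<lambda>r. death_op i f r + death_op i g r)"
  "death_op i (\<lambda>r. c * f r) = (\<lambda>r. c * death_op i f r)"
  by (simp_all add: death_op_def fun_eq_iff algebra_simps)

text \<open>For \<open>U i f = death_op i (birth_op i f)\<close> this yields the relation
  \<open>U i (U i f) = loop_A * U i f\<close>; the snake relations below yield that
  \<open>U i\<close>, \<open>U (i + 1)\<close>, \<open>U i\<close> in succession equal
  \<open>U i\<close>.\<close>

lemma birth_death_op: "birth_op i (death_op i f) = (\<lambda>r. loop_A * f r)"
  by (simp add: birth_op_def death_op_def fun_eq_iff death_birth_same birth_link.rep_eq)

lemma snake_op:
  "birth_op i (death_op (Suc i) f) = f"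
  "birth_op (Suc i) (death_op i f) = f"
  by (simp_all add: birth_op_def death_op_def fun_eq_iff death_Suc_birth death_birth_Suc
      birth_link.rep_eq)

lemma birth_birth_op:
  "birth_op (p + k) (birth_op p f) = birth_op p (birth_op (p + k + 2) f)"
  by (simp add: birth_op_def fun_eq_iff birth_birth)

lemma death_birth_op:
  "death_op (p + k) (birth_op p f) = birth_op p (death_op (p + k + 2) f)"
  by (simp add: birth_op_def death_op_def fun_eq_iff death_birth birth_link.rep_eq unskip_def)

lemma birth_death_op_far:
  "birth_op (p + k + 2) (death_op p f) = death_op p (birth_op (p + k) f)"
  by (simp add: birth_op_def death_op_def fun_eq_iff birth_death[simplified] birth_link.rep_eq unskip_def)

text \<open>If the two deaths close a circle only jointly, the factor is contributed by whichever
  comes second; only the total number of circles is independent of the order.\<close>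

lemma death_death_op:
  "death_op (p + k + 2) (death_op p f) = death_op p (death_op (p + k) f)"
proof
  fix r
  let ?q = "p + k + 2"
  obtain l :: "nat \<Rightarrow> nat \<Rightarrow> bool" where l: "linked r x y \<longleftrightarrow> l x = l y" for x y
    by (rule that[of "linked r"]) (rule linked_label)
  have "linked (death_link ?q r) p (p + 1) \<longleftrightarrow> l p = l (p + 1)
      \<or> l p = l ?q \<and> l (?q + 1) = l (p + 1) \<or> l p = l (?q + 1) \<and> l ?q = l (p + 1)"
    "linked (death_link p r) (p + k) (p + k + 1) \<longleftrightarrow> l ?q = l (?q + 1)
      \<or> l ?q = l p \<and> l (p + 1) = l (?q + 1) \<or> l ?q = l (p + 1) \<and> l p = l (?q + 1)"
    by (simp_all add: death_link.rep_eq skip_def l)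
  then show "death_op (p + k + 2) (death_op p f) r = death_op p (death_op (p + k) f) r"
    unfolding death_op_def death_death l
    by (cases "l p = l (p + 1)"; cases "l ?q = l (?q + 1)") auto
qed

section \<open>Crossings as operators, and the moves off the axis\<close>

definition cross_op :: "crossing_type \<Rightarrow> nat \<Rightarrow> functional \<Rightarrow> functional" where
  "cross_op t i f = (\<lambda>r. coeff_h A t * f r + coeff_v A t * death_op i (birth_op i f) r)"

fun event_op :: "'d event \<Rightarrow> functional \<Rightarrow> functional" where
  "event_op (Birth d i) f = birth_op i f"
| "event_op (Death d i) f = death_op i f"
| "event_op (Cross t i) f = cross_op t i f"

definition word_op :: "'d event list \<Rightarrow> functional \<Rightarrow> functional" where
  "word_op w f = foldr event_op w f"

lemma word_op_simps [simp]:
  "word_op [] f = f"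
  "word_op (e # w) f = event_op e (word_op w f)"
  "word_op (u @ v) f = word_op u (word_op v f)"
  by (simp_all add: word_op_def)

lemma event_op_map [simp]: "event_op (map_event h e) = event_op e"
  by (cases e) (simp_all add: fun_eq_iff)

lemma word_op_map [simp]: "word_op (map (map_event h) w) f = word_op w f"
  by (induction w) simp_all

lemmas op_linear = birth_op_linear death_op_linear

lemmas op_simps = cross_op_def op_linear birth_death_op snake_op

lemma event_op_linear:
  "event_op e (\<lambda>r. f r + g r) = (\<lambda>r. event_op e f r + event_op e g r)"
  "event_op e (\<lambda>r. c * f r) = (\<lambda>r. c * event_op e f r)"
  by (cases e; simp add: cross_op_def op_linear fun_eq_iff algebra_simps)+

lemma word_op_linear:
  "word_op w (\<lambda>r. f r + g r) = (\<lambda>r. word_op w f r + word_op w g r)"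
  "word_op w (\<lambda>r. c * f r) = (\<lambda>r. c * word_op w f r)"
  by (induction w) (simp_all add: event_op_linear)

text \<open>A crossing is a linear combination of the identity and a death followed by a birth, so
  the four commutations of births and deaths imply all others.\<close>

lemma far_op:
  assumes "position e + ends_left e \<le> position f"
  shows "event_op f (event_op e g)
    = event_op e (event_op (move_to (position f - ends_left e + ends_right e) f) g)"
proof -
  have bb: "birth_op q (birth_op p h) = birth_op p (birth_op (q + 2) h)"
    and db: "death_op q (birth_op p h) = birth_op p (death_op (q + 2) h)"
    if "p \<le> q" for p q h
    using that birth_birth_op[of p "q - p" h] death_birth_op[of p "q - p" h] by simp_all
  have bd: "birth_op q (death_op p h) = death_op p (birth_op (q - 2) h)"
    and dd: "death_op q (death_op p h) = death_op p (death_op (q - 2) h)"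
    if "p + 2 \<le> q" for p q h
  proof -
    obtain k where "q = p + k + 2"
      using \<open>p + 2 \<le> q\<close> le_iff_add[of "p + 2" q] by (auto simp: ac_simps)
    then show "birth_op q (death_op p h) = death_op p (birth_op (q - 2) h)"
      "death_op q (death_op p h) = death_op p (death_op (q - 2) h)"
      using birth_death_op_far[of p k h] death_death_op[of p k h] by simp_all
  qed
  have birth: "birth_op q (event_op e h) = event_op e (birth_op (q - ends_left e + ends_right e) h)"
    and death: "death_op q (event_op e h) = event_op e (death_op (q - ends_left e + ends_right e) h)"
    if "position e + ends_left e \<le> q" for q h
  proof -
    show "birth_op q (event_op e h) = event_op e (birth_op (q - ends_left e + ends_right e) h)"
    proof (cases e)
      case (Cross t p)
      then have "Suc (Suc (q - 2)) = q"
        using that by simp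
      with Cross show ?thesis
        using that bd[of p q "birth_op p h"] bb[of p "q - 2" h]
        by (simp add: cross_op_def op_linear)
    qed (use that in \<open>simp_all add: bb bd\<close>)
    show "death_op q (event_op e h) = event_op e (death_op (q - ends_left e + ends_right e) h)"
    proof (cases e)
      case (Cross t p)
      then have "Suc (Suc (q - 2)) = q"
        using that by simp
      with Cross show ?thesis
        using that dd[of p q "birth_op p h"] db[of p "q - 2" h]
        by (simp add: cross_op_def op_linear)
    qed (use that in \<open>simp_all add: db dd\<close>)
  qed
  show ?thesis
  proof (cases f)
    case (Cross t q)
    with assms birth[of q] death[of q] show ?thesis
      by (simp add: cross_op_def event_op_linear)
  qed (use assms birth death in simp_all)
qed

lemma coeff_opp [simp]:
  "coeff_h c (opp t) = coeff_v c t" "coeff_v c (opp t) = coeff_h c t"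
  by (cases t; simp)+

text \<open>In the slides, a snake relation turns the vertical smoothing on one side into the
  horizontal smoothing on the other, and \<open>opp\<close> exchanges the two coefficients
  accordingly.\<close>

lemma planar_local_op:
  assumes "planar_local x y"
  shows "word_op x f = word_op y f"
  using assms
  by cases (simp_all add: far_op op_simps add.commute)

text \<open>The factor of a kink, which the normalisation of \<open>W\<close> cancels. The base is a
  parameter because S1 produces the same expression in \<open>B\<close>.\<close>

fun kink :: "ratfun \<Rightarrow> crossing_type \<Rightarrow> ratfun" where
  "kink c Xo = - (c ^ 3)"
| "kink c Xu = - (inverse c ^ 3)"

lemma kink_A: "loop_A * coeff_h A t + coeff_v A t = kink A t"
  by (cases t) (simp_all add: loop_A_def field_simps eval_nat_numeral)

lemma kink_A': "loop_A * coeff_v A t + coeff_h A t = kink A (opp t)"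
  by (cases t) (simp_all add: loop_A_def field_simps eval_nat_numeral)

lemma R1_op:
  "word_op [Birth d (i + 1), Cross t i, Death d' (i + 1)] f = (\<lambda>r. kink A t * f r)"
  "word_op [Birth d i, Cross t (i + 1), Death d' i] f = (\<lambda>r. kink A t * f r)"
  by (simp_all add: op_simps fun_eq_iff kink_A[symmetric] algebra_simps)

text \<open>The identity gets the coefficient \<open>coeff_h A t * coeff_v A t = 1\<close>; the
  vertical smoothing gets \<open>loop_A\<close> plus the squares of the two coefficients, which is
  0.\<close>

lemma R2_op: "word_op [Cross t i, Cross (opp t) i] f = f"
proof
  fix r
  show "word_op [Cross t i, Cross (opp t) i] f r = f r"
    by (cases t; simp add: op_simps)
      (simp_all add: loop_A_def field_simps eval_nat_numeral)
qed

text \<open>By the circle and snake relations both sides are combinations of the identity, the two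
  vertical smoothings and their two products; the coefficients agree for each of the six admissible
  choices of types.\<close>

lemma R3_op:
  assumes "\<not> (a = c \<and> b \<noteq> a)"
  shows "word_op [Cross a i, Cross b (i + 1), Cross c i] f
    = word_op [Cross c (i + 1), Cross b i, Cross a (i + 1)] f"
proof
  fix r
  show "word_op [Cross a i, Cross b (i + 1), Cross c i] f r
    = word_op [Cross c (i + 1), Cross b i, Cross a (i + 1)] f r"
    using assms
    by (cases a; cases b; cases c; simp add: op_simps)
      (simp_all add: loop_A_def field_simps eval_nat_numeral)
qed

section \<open>Crossings on the axis\<close>

text \<open>
  The argument \<open>p\<close> counts the points of the axis already passed.  Since births and deaths produce
  \<open>loop_A ^ n\<close> for \<open>n\<close> circles, the final factor turns this into the value of \<open>n\<close> circles meeting the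
  axis in \<open>p\<close> points, up to the constant \<open>loop_B\<close>.
\<close>

fun axis_op :: "nat \<Rightarrow> axis_event list \<Rightarrow> functional \<Rightarrow> functional" where
  "axis_op p [] f = (\<lambda>r. (loop_B / loop_A) ^ (p div 2) * f r)"
| "axis_op p (AxisPoint # a) f = axis_op (p + 1) a f"
| "axis_op p (AxisCross t # a) f =
     (\<lambda>r. coeff_h B t * axis_op (p + 2) a f r
       + coeff_v B t * death_op p (axis_op p a (birth_op p f)) r)"

lemma axis_op_linear:
  "axis_op p a (\<lambda>r. f r + g r) = (\<lambda>r. axis_op p a f r + axis_op p a g r)"
  "axis_op p a (\<lambda>r. c * f r) = (\<lambda>r. c * axis_op p a f r)"
proof (induction a arbitrary: p f g)
  case (Cons e a)
  {
    case 1
    show ?case by (cases e) (simp_all add: Cons op_linear algebra_simps)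
  next
    case 2
    show ?case by (cases e) (simp_all add: Cons op_linear algebra_simps del: mult.commute)
  }
qed (simp_all add: algebra_simps)

text \<open>By definition the lowest crossing is smoothed first. The folds coming from different
  crossings commute up to renumbering, so any crossing may be smoothed first instead.\<close>

lemma axis_op_skein:
  "axis_op p (a1 @ AxisCross t # a2) f =
     (\<lambda>r. coeff_h B t * axis_op p (a1 @ AxisPoint # AxisPoint # a2) f r
       + coeff_v B t * death_op (p + axis_ends a1)
           (axis_op p (a1 @ a2) (birth_op (p + axis_ends a1) f)) r)"
proof (induction a1 arbitrary: p f)
  case Nil
  show ?case by simp
next
  case (Cons e a1)
  show ?case
  proof (cases e)
    case AxisPoint
    then show ?thesis using Cons.IH[of "p + 1"] by simp
  next
    case (AxisCross s)
    let ?k = "axis_ends a1"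
    have d: "death_op p (death_op (p + ?k) h) = death_op (p + ?k + 2) (death_op p h)"
      and b: "birth_op (p + ?k) (birth_op p h) = birth_op p (birth_op (p + ?k + 2) h)" for h
      by (simp_all only: death_death_op birth_birth_op)
    have p: "p + 2 + ?k = p + ?k + 2" "p + axis_ends (e # a1) = p + ?k + 2"
      using AxisCross by simp_all
    show ?thesis
      unfolding p
      unfolding AxisCross append_Cons axis_op.simps Cons.IH p op_linear d b
      by (simp only: algebra_simps)
  qed
qed

text \<open>The ends of the fold run through two of the \<open>p + 2\<close> points already passed.
  Pulling the fold off the axis preserves the circles and lowers half the number of axis points by
  one, whence one factor \<open>loop_B / loop_A\<close>.\<close>

lemma axis_op_birth_Nil:
  assumes "j \<le> p"
  shows "birth_op j (axis_op (p + 2) a f) = (\<lambda>r. loop_B / loop_A * axis_op p a (birth_op j f) r)"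
  using assms
proof (induction a arbitrary: p f)
  case Nil
  have "(p + 2) div 2 = Suc (p div 2)" by simp
  then show ?case by (simp only: axis_op.simps op_linear power_Suc mult.assoc)
next
  case (Cons e a)
  show ?case
  proof (cases e)
    case AxisPoint
    with Cons.IH[of "p + 1"] Cons.prems show ?thesis by simp
  next
    case (AxisCross s)
    obtain k where p: "p = j + k"
      using Cons.prems le_iff_add by blast
    have d: "birth_op j (death_op (p + 2) h) = death_op p (birth_op j h)"
      and b: "birth_op j (birth_op (p + 2) h) = birth_op p (birth_op j h)" for h
      by (simp_all only: death_birth_op birth_birth_op p)
    show ?thesis
      unfolding AxisCross axis_op.simps op_linear d
        Cons.IH[OF Cons.prems] Cons.IH[OF trans_le_add1[OF Cons.prems]] b
      by (simp only: algebra_simps)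
  qed
qed

lemma axis_op_birth:
  "birth_op (p + axis_ends a1) (axis_op p (a1 @ AxisPoint # AxisPoint # a2) f)
    = (\<lambda>r. loop_B / loop_A * axis_op p (a1 @ a2) (birth_op (p + axis_ends a1) f) r)"
proof (induction a1 arbitrary: p f)
  case Nil
  show ?case using axis_op_birth_Nil[of p p] by simp
next
  case (Cons e a1)
  show ?case
  proof (cases e)
    case AxisPoint
    then show ?thesis using Cons.IH[of "p + 1"] by simp
  next
    case (AxisCross s)
    let ?k = "axis_ends a1"
    have d: "birth_op (p + ?k + 2) (death_op p h) = death_op p (birth_op (p + ?k) h)"
      and b: "birth_op (p + ?k) (birth_op p h) = birth_op p (birth_op (p + ?k + 2) h)" for h
      by (rule birth_death_op_far birth_birth_op)+
    have p: "p + axis_ends (e # a1) = p + ?k + 2"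
      using AxisCross by simp
    have IH: "birth_op (p + ?k + 2) (axis_op (p + 2) (a1 @ AxisPoint # AxisPoint # a2) f)
      = (\<lambda>r. loop_B / loop_A * axis_op (p + 2) (a1 @ a2) (birth_op (p + ?k + 2) f) r)" for f
      using Cons.IH[of "p + 2"] by (simp add: ac_simps)
    show ?thesis
      unfolding p
      unfolding AxisCross append_Cons axis_op.simps op_linear d IH Cons.IH b
      by (simp only: algebra_simps)
  qed
qed

lemma axis_op_death_Nil:
  assumes "j \<le> p"
  shows "axis_op (p + 2) a (death_op j f) = (\<lambda>r. loop_B / loop_A * death_op j (axis_op p a f) r)"
  using assms
proof (induction a arbitrary: p f)
  case Nil
  have "(p + 2) div 2 = Suc (p div 2)" by simp
  then show ?case by (simp only: axis_op.simps op_linear power_Suc mult.assoc)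
next
  case (Cons e a)
  show ?case
  proof (cases e)
    case AxisPoint
    with Cons.IH[of "p + 1"] Cons.prems show ?thesis by simp
  next
    case (AxisCross s)
    obtain k where p: "p = j + k"
      using Cons.prems le_iff_add by blast
    have d: "death_op (p + 2) (death_op j h) = death_op j (death_op p h)"
      and b: "birth_op (p + 2) (death_op j h) = death_op j (birth_op p h)" for h
      by (simp_all only: death_death_op birth_death_op_far p)
    show ?thesis
      unfolding AxisCross axis_op.simps b
        Cons.IH[OF Cons.prems] Cons.IH[OF trans_le_add1[OF Cons.prems]] op_linear d
      by (simp only: algebra_simps)
  qed
qed

lemma axis_op_death:
  "axis_op p (a1 @ AxisPoint # AxisPoint # a2) (death_op (p + axis_ends a1) f)
    = (\<lambda>r. loop_B / loop_A * death_op (p + axis_ends a1) (axis_op p (a1 @ a2) f) r)"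
proof (induction a1 arbitrary: p f)
  case Nil
  show ?case using axis_op_death_Nil[of p p] by simp
next
  case (Cons e a1)
  show ?case
  proof (cases e)
    case AxisPoint
    then show ?thesis using Cons.IH[of "p + 1"] by simp
  next
    case (AxisCross s)
    let ?k = "axis_ends a1"
    have d: "death_op p (death_op (p + ?k) h) = death_op (p + ?k + 2) (death_op p h)"
      and b: "birth_op p (death_op (p + ?k + 2) h) = death_op (p + ?k) (birth_op p h)" for h
      by (simp_all only: death_death_op death_birth_op)
    have p: "p + axis_ends (e # a1) = p + ?k + 2"
      using AxisCross by simp
    have IH: "axis_op (p + 2) (a1 @ AxisPoint # AxisPoint # a2) (death_op (p + ?k + 2) f)
      = (\<lambda>r. loop_B / loop_A * death_op (p + ?k + 2) (axis_op (p + 2) (a1 @ a2) f) r)" for f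
      using Cons.IH[of "p + 2"] by (simp add: ac_simps)
    show ?thesis
      unfolding p
      unfolding AxisCross append_Cons axis_op.simps b IH Cons.IH op_linear d
      by (simp only: algebra_simps)
  qed
qed

text \<open>In the vertical smoothing the death pays \<open>loop_B / loop_A\<close> for moving left
  through the two points, and the birth needs exactly this factor to follow it.\<close>

lemma axis_op_cross:
  "axis_op p (a1 @ AxisPoint # AxisPoint # a2) (cross_op t (p + axis_ends a1) f)
    = cross_op t (p + axis_ends a1) (axis_op p (a1 @ AxisPoint # AxisPoint # a2) f)"
  unfolding cross_op_def axis_op_linear axis_op_death axis_op_birth op_linear
  by (simp only: algebra_simps)

lemma axis_ends_append [simp]: "axis_ends (a @ b) = axis_ends a + axis_ends b"
  by (induction a rule: axis_ends.induct) simp_all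

section \<open>The moves on the axis as operator identities\<close>

lemma cross_op_linear:
  "cross_op t i (\<lambda>r. f r + g r) = (\<lambda>r. cross_op t i f r + cross_op t i g r)"
  "cross_op t i (\<lambda>r. c * f r) = (\<lambda>r. c * cross_op t i f r)"
  by (simp_all add: cross_op_def op_linear algebra_simps)

lemma opp_opp [simp]: "opp (opp t) = t"
  by (cases t) simp_all

lemma cross_cross_op:
  "cross_op t i (cross_op (opp t) i f) = f" "cross_op (opp t) i (cross_op t i f) = f"
  using R2_op[of t i f] R2_op[of "opp t" i f] by simp_all

lemma slide_op:
  "birth_op i (cross_op t (i + 1) f) = birth_op (i + 1) (cross_op (opp t) i f)"
  "cross_op t i (death_op (i + 1) f) = cross_op (opp t) (i + 1) (death_op i f)"
  using planar_local_op[OF slide_birth, of "()" i t f] planar_local_op[OF slide_death, of t i "()" f]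
  by simp_all

lemma cross_cross_far:
  "cross_op s (i + 2) (cross_op t i f) = cross_op t i (cross_op s (i + 2) f)"
  using far_op[of "Cross t i" "Cross s (i + 2)" f] by simp

lemma kink_op:
  "cross_op t i (death_op i f) = (\<lambda>r. kink A (opp t) * death_op i f r)"
  "birth_op i (cross_op t i f) = (\<lambda>r. kink A (opp t) * birth_op i f r)"
  by (simp_all add: op_simps kink_A'[symmetric]) (simp_all add: algebra_simps)

lemma kink_opp: "c \<noteq> 0 \<Longrightarrow> kink c t * kink c (opp t) = 1"
  by (cases t) (simp_all add: field_simps)

lemma kink_B: "loop_B * coeff_h B t + coeff_v B t = kink B t"
  by (cases t) (simp_all add: loop_B_def field_simps eval_nat_numeral)

text \<open>A circle meeting the axis twice is worth \<open>loop_B\<close>: pulling it off the axis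
  costs \<open>loop_B / loop_A\<close>, and there it is worth \<open>loop_A\<close>.\<close>

lemma axis_circle:
  "birth_op (axis_ends a1)
     (axis_op 0 (a1 @ AxisPoint # AxisPoint # a2) (death_op (axis_ends a1) f))
   = (\<lambda>r. loop_B * axis_op 0 (a1 @ a2) f r)"
  using axis_op_birth[of 0 a1 a2 "death_op (axis_ends a1) f"]
  by (simp add: birth_death_op axis_op_linear)

text \<open>The horizontal smoothing leaves a circle meeting the axis twice, the vertical one leaves
  two snakes; the sum of the coefficients is that of R1 with \<open>B\<close> for
  \<open>A\<close>.\<close>

lemma S1_upper_op:
  assumes "i = axis_ends a1"
  shows "birth_op (i + 1) (axis_op 0 (a1 @ AxisCross s # AxisPoint # a2) (death_op (i + 1) f))
    = (\<lambda>r. kink B s * axis_op 0 (a1 @ AxisPoint # a2) f r)"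
  using axis_circle[of "a1 @ [AxisPoint]" a2 f]
  by (simp add: axis_op_skein op_simps assms kink_B[symmetric] algebra_simps)

lemma S1_lower_op:
  assumes "i = axis_ends a1"
  shows "birth_op i (axis_op 0 (a1 @ AxisPoint # AxisCross s # a2) (death_op i f))
    = (\<lambda>r. kink B s * axis_op 0 (a1 @ AxisPoint # a2) f r)"
  using axis_circle[of a1 "AxisPoint # a2" f] axis_op_skein[of 0 "a1 @ [AxisPoint]" s a2]
  by (simp add: op_simps assms kink_B[symmetric] algebra_simps)

text \<open>A vertical smoothing of the lower crossing removes its two points from the axis, so the
  upper crossing then sits at \<open>i\<close> instead of \<open>i + 2\<close>.\<close>

lemma axis_op_skein2:
  assumes "i = axis_ends a1"
  shows "axis_op 0 (a1 @ AxisCross s # AxisCross t # a2) f = (\<lambda>r.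
      coeff_h B s * (coeff_h B t
        * axis_op 0 (a1 @ AxisPoint # AxisPoint # AxisPoint # AxisPoint # a2) f r)
    + coeff_h B s * (coeff_v B t
        * death_op (i + 2) (axis_op 0 (a1 @ AxisPoint # AxisPoint # a2) (birth_op (i + 2) f)) r)
    + coeff_v B s * (coeff_h B t
        * death_op i (axis_op 0 (a1 @ AxisPoint # AxisPoint # a2) (birth_op i f)) r)
    + coeff_v B s * (coeff_v B t
        * death_op i (death_op i (axis_op 0 (a1 @ a2) (birth_op i (birth_op i f)))) r))"
  using axis_op_skein[of 0 "a1 @ [AxisPoint, AxisPoint]" t a2]
  by (simp add: axis_op_skein op_linear assms algebra_simps)

text \<open>Three of the four smoothings are multiples of the same term, with total coefficient
  \<open>loop_B\<close> plus the squares of the two coefficients, which is 0. The doubly vertical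
  one has coefficient 1 and is the right-hand side.\<close>

lemma S2v_op:
  assumes "i = axis_ends a1"
  shows "birth_op (i + 1) (axis_op 0 (a1 @ AxisCross s # AxisCross (opp s) # a2) (death_op (i + 1) f))
    = death_op i (axis_op 0 (a1 @ a2) (birth_op i f))"
proof
  fix r
  have "birth_op (Suc i) (axis_op 0 (a1 @ AxisPoint # AxisPoint # AxisPoint # AxisPoint # a2)
      (death_op (Suc i) f)) = (\<lambda>r. loop_B * axis_op 0 (a1 @ AxisPoint # AxisPoint # a2) f r)"
    using axis_circle[of "a1 @ [AxisPoint]" "AxisPoint # a2" f] by (simp add: assms)
  moreover have "loop_B + coeff_h B s * coeff_h B s + coeff_v B s * coeff_v B s = 0"
    by (cases s) (simp_all add: loop_B_def power2_eq_square)
  moreover have "coeff_h B s * coeff_v B s = 1"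
    by (cases s) simp_all
  moreover have "h * (v * (l * x)) + h * (h * x) + v * (v * x) + v * (h * y) = y"
    if "l + h * h + v * v = 0" "h * v = 1" for h v l x y :: ratfun
  proof -
    have "h * (v * (l * x)) + h * (h * x) + v * (v * x) + v * (h * y)
      = (l + h * h + v * v) * x + (h * v - 1) * (l * x + y) + y"
      by (simp add: algebra_simps)
    with that show ?thesis by simp
  qed
  ultimately show "birth_op (i + 1)
      (axis_op 0 (a1 @ AxisCross s # AxisCross (opp s) # a2) (death_op (i + 1) f)) r
    = death_op i (axis_op 0 (a1 @ a2) (birth_op i f)) r"
    by (simp add: axis_op_skein2[OF assms] op_simps)
qed

lemma S2h_op:
  assumes "i = axis_ends a1"
  shows "cross_op t i (axis_op 0 (a1 @ AxisPoint # AxisPoint # a2) (cross_op (opp t) i f))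
    = axis_op 0 (a1 @ AxisPoint # AxisPoint # a2) f"
  using axis_op_cross[of 0 a1 a2 "opp t" f] by (simp add: assms cross_cross_op)

text \<open>The horizontal smoothing is S2h. In the vertical one the outer crossings become kinks on
  the two folds, with mutually inverse factors.\<close>

lemma S2pm_op:
  assumes "i = axis_ends a1"
  shows "cross_op t i (axis_op 0 (a1 @ AxisCross s # a2) (cross_op (opp t) i f))
    = axis_op 0 (a1 @ AxisCross s # a2) f"
proof -
  have k: "c * kink A t * kink A (opp t) = c" for c
    by (simp add: mult.assoc kink_opp)
  show ?thesis
    using S2h_op[OF assms, of t a2 f]
    by (simp add: k axis_op_skein cross_op_linear kink_op axis_op_linear op_linear
        mult.left_commute[of "kink A (opp t)"] mult.assoc[symmetric] flip: assms)
qed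

text \<open>In the horizontal smoothing both sides lose their outer crossings by S2h; in the
  vertical one the third strand slides across both folds.\<close>

lemma S3_op:
  assumes "i = axis_ends a1"
  shows "cross_op t (i + 1) (axis_op 0 (a1 @ AxisCross s # AxisPoint # a2) (cross_op (opp t) (i + 1) f))
    = cross_op (opp t) i (axis_op 0 (a1 @ AxisPoint # AxisCross s # a2) (cross_op t i f))"
  using S2h_op[of "i + 1" "a1 @ [AxisPoint]" t a2 f] S2h_op[OF assms, of "opp t" "AxisPoint # a2" f]
    axis_op_skein[of 0 "a1 @ [AxisPoint]" s a2] 
  by (simp add: axis_op_skein cross_op_linear slide_op[simplified] flip: assms)

text \<open>The steep form is the case \<open>t = Xu\<close>; the flat form is the case
  \<open>t = Xo\<close> with the two sides exchanged. Terms are matched by the smoothings that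
  \<open>s\<close> and \<open>r\<close> receive; since their order along the axis differs on the two
  sides, so do the positions of the folds.\<close>

lemma S4_op:
  assumes "i = axis_ends a1"
  shows "cross_op t i (cross_op t (i + 1) (axis_op 0 (a1 @ AxisCross s # AxisCross r # a2)
      (cross_op (opp t) (i + 1) (cross_op (opp t) i f))))
    = cross_op (opp t) (i + 2) (cross_op (opp t) (i + 1)
      (axis_op 0 (a1 @ AxisCross r # AxisCross s # a2)
      (cross_op t (i + 1) (cross_op t (i + 2) f))))"
proof -
  let ?P = "AxisPoint"
  let ?d = "\<lambda>i f. death_op i f" and ?b = "\<lambda>i f. birth_op i f"
  let ?c = "\<lambda>i f. cross_op t i f" and ?c' = "\<lambda>i f. cross_op (opp t) i f"
  have i1: "i + 1 = axis_ends (a1 @ [?P])" and i2: "i + 2 = axis_ends (a1 @ [?P, ?P])"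
    by (simp_all add: assms)
  let ?X = "axis_op 0 (a1 @ ?P # ?P # ?P # ?P # a2)"
  have hh: "?c i (?c (i + 1) (?X (?c' (i + 1) (?c' i f)))) = ?X f"
    using S2h_op[OF i1, of t "?P # a2"] S2h_op[OF assms, of t "?P # ?P # a2"] by simp
  have hh': "?c' (i + 2) (?c' (i + 1) (?X (?c (i + 1) (?c (i + 2) f)))) = ?X f"
    using S2h_op[OF i1, of "opp t" "?P # a2"] S2h_op[OF i2, of "opp t" a2] by simp
  have dt: "?c i (?d (i + 1) g) = ?c' (i + 1) (?d i g)"
      "?c (i + 1) (?d (i + 2) g) = ?c' (i + 2) (?d (i + 1) g)"
      "?c (i + 1) (?d i g) = ?c' i (?d (i + 1) g)"
      "?c' (i + 1) (?d (i + 2) g) = ?c (i + 2) (?d (i + 1) g)"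
      "?c (i + 2) (?d (i + 1) g) = ?c' (i + 1) (?d (i + 2) g)"
    and bt: "?b i (?c' (i + 1) g) = ?b (i + 1) (?c i g)"
      "?b (i + 1) (?c i g) = ?b i (?c' (i + 1) g)"
      "?b (i + 1) (?c' i g) = ?b i (?c (i + 1) g)"
      "?b (i + 2) (?c' (i + 1) g) = ?b (i + 1) (?c (i + 2) g)"
      "?b (i + 2) (?c (i + 1) g) = ?b (i + 1) (?c' (i + 2) g)" for g
    using slide_op(1)[of i t g] slide_op(1)[of i "opp t" g]
      slide_op(2)[of t i g] slide_op(2)[of "opp t" i g]
      slide_op(1)[of "i + 1" t g] slide_op(1)[of "i + 1" "opp t" g]
      slide_op(2)[of t "i + 1" g] slide_op(2)[of "opp t" "i + 1" g]
    by simp_all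
  \<comment> \<open>\<open>r\<close> smoothed vertically, \<open>s\<close> horizontally: the fold
    slides across two strands, from above them on one side to below them on the other.\<close>
  have hv: "?c i (?c (i + 1) (?d (i + 2) g)) = ?c' (i + 2) (?c' (i + 1) (?d i g))"
    "?b (i + 2) (?c' (i + 1) (?c' i g)) = ?b i (?c (i + 1) (?c (i + 2) g))" for g
    by (simp_all only: dt(1,2) bt(3,4) cross_cross_far[symmetric])
      (simp_all only: cross_cross_far bt(3))
  \<comment> \<open>\<open>s\<close> smoothed vertically, \<open>r\<close> horizontally: both sides
    reduce to the same fold at \<open>i + 1\<close>.\<close>
  have vh: "?c i (?c (i + 1) (?d i g)) = ?d (i + 1) g"
    "?c' (i + 2) (?c' (i + 1) (?d (i + 2) g)) = ?d (i + 1) g"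
    "?b i (?c' (i + 1) (?c' i g)) = ?b (i + 1) g"
    "?b (i + 2) (?c (i + 1) (?c (i + 2) g)) = ?b (i + 1) g" for g
    by (simp_all only: dt(3,4) bt(1,5) cross_cross_op)
  \<comment> \<open>Two successive deaths at \<open>i\<close> are two folds side by side; closing
    the upper one first brings the terms into the form of the previous facts.\<close>
  have dd: "?d i (?d i g) = ?d (i + 2) (?d i g)" and bb: "?b i (?b i g) = ?b i (?b (i + 2) g)" for g
    using death_death_op[of i 0 g] birth_birth_op[of i 0 g] by simp_all
  have vv: "?c' (i + 2) (?c' (i + 1) (?d i (?d i g))) = ?d (i + 1) (?d i g)"
    "?b i (?b i (?c (i + 1) (?c (i + 2) g))) = ?b i (?b (i + 1) g)" for g
    by (simp_all only: dd bb vh)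
  show ?thesis
    by (simp only: axis_op_skein2[OF assms] cross_op_linear hh hh' hv vh vv)
      (simp only: algebra_simps)
qed

section \<open>Counting circles\<close>

text \<open>The unoriented counterpart of a successful \<open>run\<close>. Connectivities ignore the
  top of the stack, but counting circles and turning a word upside down depend on it.\<close>

fun fits :: "nat \<Rightarrow> 'd event list \<Rightarrow> bool" where
  "fits n [] \<longleftrightarrow> True"
| "fits n (e # w) \<longleftrightarrow>
     position e + ends_left e \<le> n \<and> fits (n - ends_left e + ends_right e) w"

lemma width_append [simp]: "width n (u @ v) = width (width n u) v"
  by (induction u arbitrary: n) simp_all

lemma fits_append [simp]: "fits n (u @ v) \<longleftrightarrow> fits n u \<and> fits (width n u) v"
  by (induction u arbitrary: n) simp_all

definition crossingless :: "'d event list \<Rightarrow> bool" where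
  "crossingless w \<longleftrightarrow> (\<forall>t i. Cross t i \<notin> set w)"

lemma crossingless_simps [simp]:
  "crossingless []"
  "crossingless (u @ v) \<longleftrightarrow> crossingless u \<and> crossingless v"
  "crossingless (e # w) \<longleftrightarrow> (\<forall>t i. e \<noteq> Cross t i) \<and> crossingless w"
  by (auto simp: crossingless_def)

fun link_after :: "'d event list \<Rightarrow> linking \<Rightarrow> linking" where
  "link_after [] r = r"
| "link_after (Birth d i # w) r = link_after w (birth_link i r)"
| "link_after (Death d i # w) r = link_after w (death_link i r)"
| "link_after (Cross t i # w) r = link_after w r"

fun loops :: "'d event list \<Rightarrow> linking \<Rightarrow> nat" where
  "loops [] r = 0"
| "loops (Birth d i # w) r = loops w (birth_link i r)"
| "loops (Death d i # w) r = (if linked r i (i + 1) then 1 else 0) + loops w (death_link i r)"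
| "loops (Cross t i # w) r = loops w r"

lemma link_after_append [simp]: "link_after (u @ v) r = link_after v (link_after u r)"
  by (induction u r rule: link_after.induct) simp_all

lemma loops_append [simp]: "loops (u @ v) r = loops u r + loops v (link_after u r)"
  by (induction u r rule: loops.induct) simp_all

lemma word_op_crossingless:
  "crossingless w \<Longrightarrow> word_op w f r = loop_A ^ loops w r * f (link_after w r)"
  by (induction w r rule: loops.induct) (simp_all add: birth_op_def death_op_def)

lemma card_image_kernel:
  assumes "\<And>x y. x \<in> S \<Longrightarrow> y \<in> S \<Longrightarrow> f x = f y \<longleftrightarrow> g x = g y"
  shows "card (f ` S) = card (g ` S)"
proof (rule bij_betw_same_card)
  let ?h = "\<lambda>z. g (inv_into S f z)"
  have h: "?h (f x) = g x" if "x \<in> S" for x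
    using assms[of "inv_into S f (f x)" x] that by (simp add: f_inv_into_f inv_into_into)
  show "bij_betw ?h (f ` S) (g ` S)"
    unfolding bij_betw_def
    by (auto simp: inj_on_def h image_image assms cong: image_cong)
qed

text \<open>Any map whose fibres on the points are the components computes the number of circles, so
  quotients need not be followed through a word.\<close>

lemma circles_eq_card_labels:
  assumes "\<And>p q. joined w p q \<Longrightarrow> l p = l q"
    and "\<And>p q. p \<in> points w \<Longrightarrow> q \<in> points w \<Longrightarrow> l p = l q \<Longrightarrow> equivclp (joined w) p q"
  shows "circles w = card (l ` points w)"
proof -
  let ?R = "{(p, q). equivclp (joined w) p q}"
  have equiv: "equiv UNIV ?R"
    by (simp add: equivp_equiv)
  have "l p = l q" if "equivclp (joined w) p q" for p q
    using that by (induction rule: equivclp_induct) (auto dest: assms(1))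
  then have "?R `` {p} = ?R `` {q} \<longleftrightarrow> l p = l q" if "p \<in> points w" "q \<in> points w" for p q
    unfolding eq_equiv_class_iff[OF equiv UNIV_I UNIV_I] using assms(2)[OF that] by blast
  then have "card ((\<lambda>p. ?R `` {p}) ` points w) = card (l ` points w)"
    by (intro card_image_kernel) auto
  moreover have "points w // ?R = (\<lambda>p. ?R `` {p}) ` points w"
    by (auto simp: quotient_def)
  ultimately show ?thesis
    by (simp add: circles_def)
qed

lemma points_snoc: "points (w @ [e]) = points w \<union> {Suc (length w)} \<times> {..<width 0 (w @ [e])}"
  by (auto simp: points_def le_Suc_eq)

lemma finite_points: "finite (points w)"
proof -
  have "points w = (\<Union>t\<le>length w. {t} \<times> {..<width 0 (take t w)})"
    by (auto simp: points_def)
  then show ?thesis by simp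
qed

lemma joined_snoc: "joined (w @ [e]) p q \<longleftrightarrow> joined w p q
   \<or> (\<exists>i j. i < width 0 w \<and> carry e i = Some j \<and> p = (length w, i) \<and> q = (Suc (length w), j))
   \<or> (\<exists>d i. e = Birth d i \<and> p = (Suc (length w), i) \<and> q = (Suc (length w), i + 1))
   \<or> (\<exists>d i. e = Death d i \<and> p = (length w, i) \<and> q = (length w, i + 1))"
  (is "_ \<longleftrightarrow> ?R")
proof
  assume "joined (w @ [e]) p q"
  then show ?R
  proof cases
    case (strand t i j)
    then show ?thesis
      using joined.strand[of t w i j] by (cases "t < length w") (auto simp: nth_append less_Suc_eq)
  next
    case (birth t d i)
    then show ?thesis
      using joined.birth[of t w d i] by (cases "t < length w") (auto simp: nth_append less_Suc_eq)
  next
    case (death t d i)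
    then show ?thesis
      using joined.death[of t w d i] by (cases "t < length w") (auto simp: nth_append less_Suc_eq)
  qed
next
  assume ?R
  then show "joined (w @ [e]) p q"
  proof (elim disjE exE conjE)
    assume "joined w p q"
    then show ?thesis
    proof cases
      case (strand t i j)
      then show ?thesis using joined.strand[of t "w @ [e]" i j] by (simp add: nth_append)
    next
      case (birth t d i)
      then show ?thesis using joined.birth[of t "w @ [e]" d i] by (simp add: nth_append)
    next
      case (death t d i)
      then show ?thesis using joined.death[of t "w @ [e]" d i] by (simp add: nth_append)
    qed
  next
    fix i j assume "i < width 0 w" "carry e i = Some j" "p = (length w, i)" "q = (Suc (length w), j)"
    then show ?thesis using joined.strand[of "length w" "w @ [e]" i j] by simp
  next
    fix d i assume "e = Birth d i" "p = (Suc (length w), i)" "q = (Suc (length w), i + 1)"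
    then show ?thesis using joined.birth[of "length w" "w @ [e]" d i] by simp
  next
    fix d i assume "e = Death d i" "p = (length w, i)" "q = (length w, i + 1)"
    then show ?thesis using joined.death[of "length w" "w @ [e]" d i] by simp
  qed
qed

lemma joined_level: "joined w p q \<Longrightarrow> fst p \<le> length w \<and> fst q \<le> length w"
  by (cases rule: joined.cases) auto

lemma equivclp_mono: "(\<And>x y. P x y \<Longrightarrow> Q x y) \<Longrightarrow> equivclp P x y \<Longrightarrow> equivclp Q x y"
proof -
  assume P: "\<And>x y. P x y \<Longrightarrow> Q x y" and "equivclp P x y"
  from this(2) show "equivclp Q x y"
    by (induction rule: equivclp_induct) (auto intro: equivclp_into_equivclp P)
qed

text \<open>
  Components of a word are counted by a labelling of its points whose fibres are the components; it is
  extended event by event, with a fresh label at a birth and a merger of two labels at a death.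
\<close>

lemma labelling_Birth:
  fixes w :: "'d event list" and d :: 'd and k :: nat
  assumes k: "k \<le> width 0 w"
    and l: "\<And>p q. joined w p q \<Longrightarrow> l p = (l q :: nat)"
      "\<And>p q. p \<in> points w \<Longrightarrow> q \<in> points w \<Longrightarrow> l p = l q \<Longrightarrow> equivclp (joined w) p q"
      "\<And>i j. i < width 0 w \<Longrightarrow> j < width 0 w \<Longrightarrow>
        linked r i j \<longleftrightarrow> l (length w, i) = l (length w, j)"
  defines "w' \<equiv> w @ [Birth d k]"
  obtains l' :: "nat \<times> nat \<Rightarrow> nat" where "\<And>p q. joined w' p q \<Longrightarrow> l' p = l' q"
    "\<And>p q. p \<in> points w' \<Longrightarrow> q \<in> points w' \<Longrightarrow> l' p = l' q \<Longrightarrow> equivclp (joined w') p q"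
    "\<And>i j. i < width 0 w' \<Longrightarrow> j < width 0 w' \<Longrightarrow>
        linked (birth_link k r) i j \<longleftrightarrow> l' (length w', i) = l' (length w', j)"
    "card (l' ` points w') = Suc (card (l ` points w))"
proof -
  let ?n = "length w"
  obtain z where z: "z \<notin> l ` points w"
    using finite_points[of w] ex_new_if_finite[of "l ` points w"] by auto
  define l' where "l' p = (if fst p \<le> ?n then l p else if snd p = k \<or> snd p = Suc k then z
      else l (?n, unskip k (snd p)))" for p
  have top: "(?n, i) \<in> points w" if "i < width 0 w" for i
    using that by (simp add: points_def)
  have level: "fst p \<le> ?n" if "p \<in> points w" for p
    using that by (auto simp: points_def)
  \<comment> \<open>Each point of \<open>w'\<close> lies on the newborn arc or is connected to an
    old point with the same label; this reduces the claim about fibres to that for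
    \<open>w\<close>.\<close>
  have anchor: "p \<in> {(Suc ?n, k), (Suc ?n, Suc k)} \<and> l' p = z \<or>
      (\<exists>p'\<in>points w. l' p = l p' \<and> equivclp (joined w') p p')" if "p \<in> points w'" for p
  proof (cases "p \<in> points w")
    case True
    then show ?thesis
      using level[OF True] by (auto simp: l'_def intro!: bexI[of _ p])
  next
    case False
    with that obtain i where p: "p = (Suc ?n, i)" "i < width 0 w + 2"
      by (auto simp: points_snoc w'_def)
    show ?thesis
    proof (cases "i = k \<or> i = Suc k")
      case True
      then show ?thesis by (auto simp: l'_def p)
    next
      case False
      with p k have u: "unskip k i < width 0 w" "carry (Birth d k) (unskip k i) = Some i"
        by (auto simp: unskip_def)
      have "joined w' (?n, unskip k i) p"
        unfolding w'_def joined_snoc using u p(1) by blast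
      with False p(1) top[OF u(1)] show ?thesis
        by (auto simp: l'_def intro!: bexI[of _ "(?n, unskip k i)"] converse_r_into_equivclp)
    qed
  qed
  have old: "equivclp (joined w') p q" if "equivclp (joined w) p q" for p q
    using that by (rule equivclp_mono[rotated]) (simp add: w'_def joined_snoc)
  show thesis
  proof
    fix p q assume "joined w' p q"
    then consider "joined w p q"
      | i j where "i < width 0 w" "carry (Birth d k) i = Some j" "p = (?n, i)" "q = (Suc ?n, j)"
      | "p = (Suc ?n, k)" "q = (Suc ?n, k + 1)"
      unfolding w'_def joined_snoc by blast
    then show "l' p = l' q"
    proof cases
      case 1
      then show ?thesis using l(1)[OF 1] joined_level[OF 1] by (simp add: l'_def)
    qed (auto simp: l'_def unskip_def split: if_splits)
  next
    fix p q assume pq: "p \<in> points w'" "q \<in> points w'" and eq: "l' p = l' q"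
    have kk: "equivclp (joined w') (Suc ?n, k) (Suc ?n, Suc k)"
      by (rule r_into_equivclp) (simp add: w'_def joined_snoc)
    show "equivclp (joined w') p q"
      using anchor[OF pq(1)]
    proof
      assume p: "p \<in> {(Suc ?n, k), (Suc ?n, Suc k)} \<and> l' p = z"
      with anchor[OF pq(2)] eq z have "q \<in> {(Suc ?n, k), (Suc ?n, Suc k)}"
        by auto
      with p kk show ?thesis
        by (auto intro: equivclp_sym equivclp_refl)
    next
      assume "\<exists>p'\<in>points w. l' p = l p' \<and> equivclp (joined w') p p'"
      then obtain p' where p': "p' \<in> points w" "l' p = l p'" "equivclp (joined w') p p'"
        by blast
      have "l p' \<noteq> z" using z p'(1) by (metis imageI)
      with eq p'(2) have "l' q \<noteq> z" by simp
      with anchor[OF pq(2)] obtain q' where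
        q': "q' \<in> points w" "l' q = l q'" "equivclp (joined w') q q'"
        by blast
      with p' eq have "equivclp (joined w') p' q'"
        using l(2) old by simp
      then show ?thesis
        by (rule equivclp_trans[OF p'(3) equivclp_trans[OF _ equivclp_sym[OF q'(3)]]])
    qed
  next
    fix i j assume "i < width 0 w'" "j < width 0 w'"
    then have ij: "i < width 0 w + 2" "j < width 0 w + 2"
      by (simp_all add: w'_def)
    have u: "unskip k i < width 0 w \<and> l (?n, unskip k i) \<noteq> z"
      if "i < width 0 w + 2" "i \<noteq> k" "i \<noteq> Suc k" for i
    proof -
      have "unskip k i < width 0 w"
        using that k by (auto simp: unskip_def)
      with top z show ?thesis by force
    qed
    show "linked (birth_link k r) i j \<longleftrightarrow> l' (length w', i) = l' (length w', j)"
      using u[OF ij(1)] u[OF ij(2)] l(3)[of "unskip k i" "unskip k j"]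
      by (auto simp: w'_def l'_def birth_link.rep_eq)
  next
    have "l' ` points w' = insert z (l ` points w)"
    proof (intro set_eqI iffI)
      fix x assume "x \<in> l' ` points w'"
      with anchor show "x \<in> insert z (l ` points w)" by blast
    next
      fix x assume "x \<in> insert z (l ` points w)"
      moreover have "z \<in> l' ` points w'"
        using k by (intro image_eqI[of _ _ "(Suc ?n, k)"]) (auto simp: l'_def w'_def points_snoc)
      moreover have "l p \<in> l' ` points w'" if "p \<in> points w" for p
        using that level[OF that]
        by (intro image_eqI[of _ _ p]) (auto simp: l'_def w'_def points_snoc)
      ultimately show "x \<in> l' ` points w'" by blast
    qed
    with z show "card (l' ` points w') = Suc (card (l ` points w))"
      by (simp add: finite_points)
  qed
qed

lemma labelling_Death:
  fixes w :: "'d event list" and d :: 'd and k :: nat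
  assumes k: "k + 1 < width 0 w"
    and l: "\<And>p q. joined w p q \<Longrightarrow> l p = (l q :: nat)"
      "\<And>p q. p \<in> points w \<Longrightarrow> q \<in> points w \<Longrightarrow> l p = l q \<Longrightarrow> equivclp (joined w) p q"
      "\<And>i j. i < width 0 w \<Longrightarrow> j < width 0 w \<Longrightarrow>
        linked r i j \<longleftrightarrow> l (length w, i) = l (length w, j)"
  defines "w' \<equiv> w @ [Death d k]"
  obtains l' :: "nat \<times> nat \<Rightarrow> nat" where "\<And>p q. joined w' p q \<Longrightarrow> l' p = l' q"
    "\<And>p q. p \<in> points w' \<Longrightarrow> q \<in> points w' \<Longrightarrow> l' p = l' q \<Longrightarrow> equivclp (joined w') p q"
    "\<And>i j. i < width 0 w' \<Longrightarrow> j < width 0 w' \<Longrightarrow>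
        linked (death_link k r) i j \<longleftrightarrow> l' (length w', i) = l' (length w', j)"
    "card (l' ` points w') + (if linked r k (k + 1) then 0 else 1) = card (l ` points w)"
proof -
  let ?n = "length w"
  let ?a = "l (?n, k)" and ?b = "l (?n, Suc k)"
  \<comment> \<open>Renaming \<open>?a\<close> to \<open>?b\<close> performs the merger. It is the
    identity precisely when the labels already agree, that is, when the death closes a
    circle.\<close>
  define m where "m x = (if x = ?a then ?b else x)" for x
  define l' where "l' p = m (if fst p \<le> ?n then l p else l (?n, skip k (snd p)))" for p
  have top: "(?n, i) \<in> points w" if "i < width 0 w" for i
    using that by (simp add: points_def)
  have level: "fst p \<le> ?n" if "p \<in> points w" for p
    using that by (auto simp: points_def)
  have anchor: "\<exists>p'\<in>points w. l' p = m (l p') \<and> equivclp (joined w') p p'"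
    if "p \<in> points w'" for p
  proof (cases "p \<in> points w")
    case True
    then show ?thesis
      using level[OF True] by (auto simp: l'_def intro!: bexI[of _ p])
  next
    case False
    with that obtain i where p: "p = (Suc ?n, i)" "i < width 0 w - 2"
      by (auto simp: points_snoc w'_def)
    with k have u: "skip k i < width 0 w" "carry (Death d k) (skip k i) = Some i"
      by (auto simp: skip_def)
    have "joined w' (?n, skip k i) p"
      unfolding w'_def joined_snoc using u p(1) by blast
    with p(1) top[OF u(1)] show ?thesis
      by (auto simp: l'_def intro!: bexI[of _ "(?n, skip k i)"] converse_r_into_equivclp)
  qed
  have old: "equivclp (joined w') p q" if "equivclp (joined w) p q" for p q
    using that by (rule equivclp_mono[rotated]) (simp add: w'_def joined_snoc)
  show thesis
  proof
    fix p q assume "joined w' p q"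
    then consider "joined w p q"
      | i j where "i < width 0 w" "carry (Death d k) i = Some j" "p = (?n, i)" "q = (Suc ?n, j)"
      | "p = (?n, k)" "q = (?n, k + 1)"
      unfolding w'_def joined_snoc by blast
    then show "l' p = l' q"
    proof cases
      case 1
      then show ?thesis using l(1)[OF 1] joined_level[OF 1] by (simp add: l'_def)
    next
      case (2 i j)
      then have "skip k j = i" by (auto simp: skip_def split: if_splits)
      with 2 show ?thesis by (simp add: l'_def)
    qed (simp add: l'_def m_def)
  next
    fix p q assume pq: "p \<in> points w'" "q \<in> points w'" and eq: "l' p = l' q"
    obtain p' where p': "p' \<in> points w" "l' p = m (l p')" "equivclp (joined w') p p'"
      using anchor[OF pq(1)] by blast
    obtain q' where q': "q' \<in> points w" "l' q = m (l q')" "equivclp (joined w') q q'"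
      using anchor[OF pq(2)] by blast
    have kk: "equivclp (joined w') (?n, k) (?n, Suc k)"
      by (rule r_into_equivclp) (simp add: w'_def joined_snoc)
    have ka: "equivclp (joined w') x (?n, k)" if "x \<in> points w" "l x = ?a" for x
      using that k by (intro old l(2) top) auto
    have kb: "equivclp (joined w') x (?n, Suc k)" if "x \<in> points w" "l x = ?b" for x
      using that k by (intro old l(2) top) auto
    have "l p' = l q' \<or> l p' = ?a \<and> l q' = ?b \<or> l p' = ?b \<and> l q' = ?a"
      using eq p' q' by (auto simp: m_def split: if_splits)
    then have "equivclp (joined w') p' q'"
    proof (elim disjE conjE)
      assume "l p' = l q'"
      then show ?thesis using p' q' l(2) old by simp
    next
      assume "l p' = ?a" "l q' = ?b"
      then show ?thesis
        by (intro equivclp_trans[OF ka[OF p'(1)] equivclp_trans[OF kk equivclp_sym[OF kb[OF q'(1)]]]])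
    next
      assume "l p' = ?b" "l q' = ?a"
      then show ?thesis
        by (intro equivclp_trans[OF kb[OF p'(1)]
            equivclp_trans[OF equivclp_sym[OF kk] equivclp_sym[OF ka[OF q'(1)]]]])
    qed
    then show "equivclp (joined w') p q"
      by (rule equivclp_trans[OF p'(3) equivclp_trans[OF _ equivclp_sym[OF q'(3)]]])
  next
    fix i j assume "i < width 0 w'" "j < width 0 w'"
    then have ij: "skip k i < width 0 w" "skip k j < width 0 w"
      using k by (auto simp: w'_def skip_def)
    show "linked (death_link k r) i j \<longleftrightarrow> l' (length w', i) = l' (length w', j)"
      using k ij by (auto simp: w'_def l'_def m_def death_link.rep_eq l(3))
  next
    have "l' ` points w' = m ` l ` points w"
    proof (intro set_eqI iffI)
      fix x assume "x \<in> l' ` points w'"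
      with anchor show "x \<in> m ` l ` points w" by blast
    next
      fix x assume "x \<in> m ` l ` points w"
      then obtain p where p: "p \<in> points w" "x = m (l p)" by blast
      with level[of p] show "x \<in> l' ` points w'"
        by (intro image_eqI[of _ _ p]) (auto simp: l'_def w'_def points_snoc)
    qed
    moreover have "m ` l ` points w = (if ?a = ?b then l ` points w else l ` points w - {?a})"
    proof -
      have "?b \<in> l ` points w"
        using k top[of "Suc k"] by simp
      then show ?thesis
        by (auto simp: m_def image_iff)
    qed
    moreover have "linked r k (k + 1) \<longleftrightarrow> ?a = ?b"
      using k l(3)[of k "k + 1"] by simp
    moreover have "?a \<in> l ` points w"
      using k top[of k] by simp
    ultimately show "card (l' ` points w') + (if linked r k (k + 1) then 0 else 1)
        = card (l ` points w)"
      using card_Suc_Diff1[of "l ` points w" ?a] by (simp add: finite_points)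
  qed
qed

text \<open>In the last conjunct, \<open>width 0 w\<close> accounts for the arcs, each of which has two ends at the right.\<close>

lemma labelling_exists:
  assumes "crossingless w" "fits 0 w"
  shows "\<exists>l :: nat \<times> nat \<Rightarrow> nat. (\<forall>p q. joined w p q \<longrightarrow> l p = l q)
    \<and> (\<forall>p\<in>points w. \<forall>q\<in>points w. l p = l q \<longrightarrow> equivclp (joined w) p q)
    \<and> (\<forall>i<width 0 w. \<forall>j<width 0 w. linked (link_after w unlinked) i j
        \<longleftrightarrow> l (length w, i) = l (length w, j))
    \<and> 2 * card (l ` points w) = 2 * loops w unlinked + width 0 w"
  using assms
proof (induction w rule: rev_induct)
  case Nil
  show ?case by (auto simp: points_def joined.simps)
next
  case (snoc e w)
  from snoc.prems have "crossingless w" "fits 0 w" by simp_all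
  from snoc.IH[OF this] obtain l :: "nat \<times> nat \<Rightarrow> nat" where
    "\<forall>p q. joined w p q \<longrightarrow> l p = l q"
    "\<forall>p\<in>points w. \<forall>q\<in>points w. l p = l q \<longrightarrow> equivclp (joined w) p q"
    "\<forall>i<width 0 w. \<forall>j<width 0 w. linked (link_after w unlinked) i j
        \<longleftrightarrow> l (length w, i) = l (length w, j)"
    and card: "2 * card (l ` points w) = 2 * loops w unlinked + width 0 w"
    by (elim exE conjE)
  note l = this(1-3)[rule_format]
  show ?case
  proof (cases e)
    case (Birth d k)
    with snoc have "k \<le> width 0 w" by simp
    then show ?thesis
    proof (rule labelling_Birth[OF _ l, where d = d])
      fix l' :: "nat \<times> nat \<Rightarrow> nat"
      let ?w = "w @ [Birth d k]"
      assume l': "\<And>p q. joined ?w p q \<Longrightarrow> l' p = l' q"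
        "\<And>p q. p \<in> points ?w \<Longrightarrow> q \<in> points ?w \<Longrightarrow> l' p = l' q \<Longrightarrow> equivclp (joined ?w) p q"
        "\<And>i j. i < width 0 ?w \<Longrightarrow> j < width 0 ?w \<Longrightarrow>
          linked (birth_link k (link_after w unlinked)) i j \<longleftrightarrow> l' (length ?w, i) = l' (length ?w, j)"
        "card (l' ` points ?w) = Suc (card (l ` points w))"
      show ?thesis
        unfolding Birth
      proof (intro exI[of _ l'] conjI allI ballI impI)
        show "linked (link_after ?w unlinked) i j \<longleftrightarrow> l' (length ?w, i) = l' (length ?w, j)"
          if "i < width 0 ?w" "j < width 0 ?w" for i j
          using l'(3)[OF that] by simp
        show "2 * card (l' ` points ?w) = 2 * loops ?w unlinked + width 0 ?w"
          using l'(4) card by simp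
      qed (fact l'(1), fact l'(2))
    qed
  next
    case (Death d k)
    with snoc have k: "k + 1 < width 0 w" by simp
    then show ?thesis
    proof (rule labelling_Death[OF _ l, where d = d])
      fix l' :: "nat \<times> nat \<Rightarrow> nat"
      let ?w = "w @ [Death d k]"
      assume l': "\<And>p q. joined ?w p q \<Longrightarrow> l' p = l' q"
        "\<And>p q. p \<in> points ?w \<Longrightarrow> q \<in> points ?w \<Longrightarrow> l' p = l' q \<Longrightarrow> equivclp (joined ?w) p q"
        "\<And>i j. i < width 0 ?w \<Longrightarrow> j < width 0 ?w \<Longrightarrow>
          linked (death_link k (link_after w unlinked)) i j \<longleftrightarrow> l' (length ?w, i) = l' (length ?w, j)"
        "card (l' ` points ?w) + (if linked (link_after w unlinked) k (k + 1) then 0 else 1)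
          = card (l ` points w)"
      show ?thesis
        unfolding Death
      proof (intro exI[of _ l'] conjI allI ballI impI)
        show "linked (link_after ?w unlinked) i j \<longleftrightarrow> l' (length ?w, i) = l' (length ?w, j)"
          if "i < width 0 ?w" "j < width 0 ?w" for i j
          using l'(3)[OF that] by simp
        \<comment> \<open>The width drops by two either way: closing an arc yields one more loop, a
          merger leaves one label less.\<close>
        show "2 * card (l' ` points ?w) = 2 * loops ?w unlinked + width 0 ?w"
          using l'(4) card k by (auto split: if_splits)
      qed (fact l'(1), fact l'(2))
    qed
  next
    case (Cross t k)
    with snoc.prems show ?thesis by simp
  qed
qed

text \<open>Once no strand is open, each component has been closed by exactly one death.\<close>

lemma circles_eq_loops:
  assumes "crossingless w" "fits 0 w" "width 0 w = 0"
  shows "circles w = loops w unlinked"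
proof -
  from labelling_exists[OF assms(1,2)] obtain l :: "nat \<times> nat \<Rightarrow> nat" where l:
    "\<forall>p q. joined w p q \<longrightarrow> l p = l q"
    "\<forall>p\<in>points w. \<forall>q\<in>points w. l p = l q \<longrightarrow> equivclp (joined w) p q"
    "2 * card (l ` points w) = 2 * loops w unlinked + width 0 w"
    by (elim exE conjE)
  show ?thesis
    using circles_eq_card_labels[OF l(1,2)[rule_format]] l(3) assms(3) by simp
qed

section \<open>The bracket as an operator\<close>

text \<open>Smoothing preserves the numbers of strands at both ends of a word, so \<open>f\<close>
  need only be known on crossingless words with these numbers.\<close>

lemma resolve_eval:
  assumes "\<And>w. crossingless w \<Longrightarrow> fits n w \<Longrightarrow> width n w = m \<Longrightarrow> f w = word_op w g r"
    and "fits n w" "width n w = m"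
  shows "resolve f w = word_op w g r"
proof -
  \<comment> \<open>\<open>resolve\<close> stores the events already read in its function argument;
    the prefix \<open>u\<close> makes them explicit for the induction.\<close>
  have "resolve (\<lambda>w'. f (u @ w')) w = word_op (u @ w) g r"
    if "crossingless u" "fits n (u @ w)" "width n (u @ w) = m" for u
    using that
  proof (induction w arbitrary: u)
    case Nil
    then show ?case using assms(1)[of u] by simp
  next
    case (Cons e w)
    show ?case
    proof (cases e)
      case (Birth d i)
      with Cons.IH[of "u @ [e]"] Cons.prems show ?thesis by simp
    next
      case (Death d i)
      with Cons.IH[of "u @ [e]"] Cons.prems show ?thesis by simp
    next
      case (Cross t i)
      moreover from this Cons.prems have "Suc (Suc (width n u - 2)) = width n u"
        by auto
      ultimately show ?thesis
        using Cons.IH[of u] Cons.IH[of "u @ [Death () i, Birth () i]"] Cons.prems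
        by (cases t) (simp_all add: cross_op_def word_op_linear)
    qed
  qed
  from this[of "[]"] assms(2,3) show ?thesis by simp
qed

text \<open>With \<open>m = p div 2\<close>, the exponents \<open>n - m\<close> and
  \<open>m - 1\<close> are regrouped: the circles give \<open>loop_A ^ n\<close>, the axis gives the
  power of \<open>loop_B / loop_A\<close>, and \<open>inverse loop_B\<close> is left over.\<close>

lemma circle_value_eval:
  assumes "crossingless L" "crossingless R" "fits 0 (L @ R)" "width 0 (L @ R) = 0"
  shows "circle_value L p R = inverse loop_B * (loop_B / loop_A) ^ (p div 2)
    * word_op (L @ R) (\<lambda>_. 1) unlinked"
  unfolding circle_value_def Let_def loop_A_def[symmetric] loop_B_def[symmetric]
  using assms
  by (simp add: circles_eq_loops word_op_crossingless power_int_diff power_divide power_add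
      divide_inverse power_mult_distrib power_inverse flip: of_nat_add)

lemma axis_bracket_eval:
  assumes "fits 0 L" "width 0 L = p + axis_ends a"
    "fits (p + axis_ends a) R" "width (p + axis_ends a) R = 0"
  shows "axis_bracket p L a R
    = inverse loop_B * word_op L (axis_op p a (word_op R (\<lambda>_. 1))) unlinked"
  using assms
proof (induction p L a R rule: axis_bracket.induct)
  case (1 p L R)
  let ?c = "inverse loop_B * (loop_B / loop_A) ^ (p div 2)"
  \<comment> \<open>For a fixed crossingless \<open>L'\<close>, its loops become a scalar and its
    connectivity the starting point for \<open>R\<close>.\<close>
  have "resolve (circle_value L' p) R = word_op L' (\<lambda>r. ?c * word_op R (\<lambda>_. 1) r) unlinked"
    if L': "crossingless L'" "fits 0 L'" "width 0 L' = p" for L'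
  proof -
    have "resolve (circle_value L' p) R
      = word_op R (\<lambda>_. ?c * loop_A ^ loops L' unlinked) (link_after L' unlinked)"
    proof (rule resolve_eval)
      fix R' :: "unit event list"
      assume R': "crossingless R'" "fits p R'" "width p R' = 0"
      show "circle_value L' p R'
        = word_op R' (\<lambda>_. ?c * loop_A ^ loops L' unlinked) (link_after L' unlinked)"
        using L' R' by (simp add: circle_value_eval word_op_crossingless)
    qed (use 1 in simp_all)
    also have "\<dots> = ?c * loop_A ^ loops L' unlinked * word_op R (\<lambda>_. 1) (link_after L' unlinked)"
      using word_op_linear(2)[of R "?c * loop_A ^ loops L' unlinked" "\<lambda>_. 1"] by simp
    finally show ?thesis
      using L' by (simp add: word_op_crossingless)
  qed
  then have "resolve (\<lambda>L'. resolve (\<lambda>R'. circle_value L' p R') R) L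
    = word_op L (\<lambda>r. ?c * word_op R (\<lambda>_. 1) r) unlinked"
    using 1 by (intro resolve_eval) simp_all
  then show ?case
    by (simp add: word_op_linear mult.assoc)
qed (simp_all add: word_op_linear algebra_simps)

definition diagram_fits :: "'d diagram \<Rightarrow> bool" where
  "diagram_fits = (\<lambda>(L, a, R). fits 0 L \<and> width 0 L = axis_ends a
     \<and> fits (axis_ends a) R \<and> width (axis_ends a) R = 0)"

lemma bracket_eval:
  "diagram_fits (L, a, R) \<Longrightarrow>
    bracket (L, a, R) = inverse loop_B * word_op L (axis_op 0 a (word_op R (\<lambda>_. 1))) unlinked"
  using axis_bracket_eval[of L 0 a R] by (simp add: diagram_fits_def)

section \<open>Orientations and writhe\<close>

lemma run_append: "run s (u @ v) = Option.bind (run s u) (\<lambda>s'. run s' v)"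
  by (induction u arbitrary: s) (simp_all split: bind_split)

lemma writhe_append: "run s u = Some s' \<Longrightarrow> writhe s (u @ v) = writhe s u + writhe s' v"
  by (induction u arbitrary: s) (auto split: bind_splits)

lemma step_fits: "step s e = Some t \<Longrightarrow>
    position e + ends_left e \<le> length s \<and> length t = length s - ends_left e + ends_right e"
  by (cases e) (auto split: if_splits)

lemma run_fits: "run s w = Some t \<Longrightarrow> fits (length s) w \<and> width (length s) w = length t"
proof (induction w arbitrary: s)
  case (Cons e w)
  then obtain s' where "step s e = Some s'" "run s' w = Some t"
    by (auto split: bind_splits)
  with Cons.IH[of s'] step_fits[of s e s'] show ?case by simp
qed simp

lemma axis_run_length: "axis_run s a = Some t \<Longrightarrow> length s = axis_ends a \<and> length t = axis_ends a"
  by (induction s a arbitrary: t rule: axis_run.induct) auto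

lemma axis_ends_Cons [simp]: "axis_ends (e # a) \<noteq> 0"
  by (cases e) simp_all

lemma axis_run_total:
  assumes "length s = axis_ends a"
  obtains t where "axis_run s a = Some t" "length t = length s"
proof -
  have "\<exists>t. axis_run s a = Some t"
    using assms by (induction s a rule: axis_run.induct) auto
  with that axis_run_length assms show thesis by metis
qed

lemma axis_run_append:
  "axis_run s a = Some t \<Longrightarrow> axis_run (s @ s') (a @ a') = map_option ((@) t) (axis_run s' a')"
  by (induction s a arbitrary: t rule: axis_run.induct; cases "axis_run s' a'") auto

lemma axis_writhe_append:
  "axis_run s a = Some t \<Longrightarrow> axis_writhe (s @ s') (a @ a') = axis_writhe s a + axis_writhe s' a'"
  by (induction s a arbitrary: t rule: axis_run.induct) auto

lemma oriented_diagramE: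
  assumes "oriented_diagram (L, a, R)"
  obtains s t where "run [] L = Some s" "axis_run s a = Some t" "run t R = Some []"
  using assms by (auto simp: oriented_diagram_def split: bind_splits)

lemma oriented_diagram_fits: "oriented_diagram D \<Longrightarrow> diagram_fits D"
  by (cases D) (auto elim!: oriented_diagramE dest!: run_fits axis_run_length simp: diagram_fits_def)

lemma fits_map [simp]: "fits n (map (map_event h) w) = fits n w"
proof (induction w arbitrary: n)
  case (Cons e w)
  then show ?case by (cases e) simp_all
qed simp

lemma width_map [simp]: "width n (map (map_event h) w) = width n w"
proof (induction w arbitrary: n)
  case (Cons e w)
  then show ?case by (cases e) simp_all
qed simp

lemma W_eval:
  assumes "oriented_diagram (L, a, R)"
  shows "W (L, a, R) = inverse loop_B * word_op L (axis_op 0 a (word_op R (\<lambda>_. 1))) unlinked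
     * (- (inverse A ^ 3)) powi alpha (L, a, R) * (- (inverse B ^ 3)) powi beta (L, a, R)"
  using oriented_diagram_fits[OF assms] 
  by (simp add: W_def bracket_eval diagram_fits_def del: bracket.simps alpha.simps beta.simps)

section \<open>Moves off the axis\<close>

text \<open>At the crossing of a kink both branches run in the same horizontal direction, so the
  sign depends only on the type.\<close>

lemma kink_sign: "c \<noteq> 0 \<Longrightarrow> kink c t * (- (inverse c ^ 3)) powi crossing_sign t d d = 1"
  by (cases t) (simp_all add: crossing_sign_def power_int_minus field_simps)

lemma step_nth_below: "step s e = Some s' \<Longrightarrow> j < position e \<Longrightarrow> s' ! j = s ! j"
  by (cases e) (auto simp: nth_append split: if_splits)

lemma step_nth_above:
  assumes "step s e = Some s'" "position e + ends_left e \<le> j" "j < length s"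
  shows "s' ! (j - ends_left e + ends_right e) = s ! j"
proof -
  obtain k where "j = position e + ends_left e + k"
    using assms(2) le_iff_add by blast
  with assms show ?thesis
    by (cases e) (auto simp: nth_append min_def split: if_splits)
qed

text \<open>In a slide the crossing changes type, but it also meets the other branch of the fold,
  whose direction is opposite; the sign is unchanged.\<close>

lemma planar_local_writhe:
  assumes "planar_local x y" "run s x = Some t" "run s y = Some t"
  shows "writhe s x = writhe s y"
  using assms
proof cases
  case (far e f)
  show ?thesis
  proof -
    obtain s1 s2 where s: "step s f = Some s1" "step s e = Some s2"
      using far assms(2,3) by (auto split: bind_splits)
    let ?k = "position f - ends_left e + ends_right e"
    have "event_sign s1 e = event_sign s e"
      using far(3) step_nth_below[OF s(1)] by (cases e) auto
    moreover have "event_sign s2 (move_to ?k f) = event_sign s f"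
      using far(3) step_nth_above[OF s(2), of "position f"] step_fits[OF s(1)]
        step_nth_above[OF s(2), of "Suc (position f)"]
      by (cases f) (auto simp: Suc_diff_le)
    ultimately show ?thesis
      using far s by simp
  qed
next
  case (slide_birth d i t)
  then show ?thesis
    using assms(2,3) by (cases t) (auto simp: nth_append crossing_sign_def min_def split: if_splits)
next
  case (slide_death t i d)
  then show ?thesis
    using assms(2,3) by (cases t) (auto simp: nth_append crossing_sign_def min_def split: if_splits)
qed simp_all

lemma split_at:
  assumes "i + k \<le> length s"
  obtains s1 m s2 where "s = s1 @ m @ s2" "length s1 = i" "length m = k"
  using that[of "take i s" "take k (drop i s)" "drop k (drop i s)"] assms
  by (simp del: drop_drop)

text \<open>The scalar is the kink factor for R1 and 1 for R2 and R3. Its compensation by the change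
  of writhe is all that \<open>W\<close> needs to know about a local move.\<close>

lemma off_axis_local_change:
  fixes x y :: "bool event list"
  assumes "off_axis_local x y" "run s x = Some t" "run s y = Some t"
  shows "\<exists>c. (\<forall>f. word_op x f = (\<lambda>r. c * word_op y f r))
    \<and> c * (- (inverse A ^ 3)) powi (writhe s x - writhe s y) = 1"
  using assms(1)
proof cases
  case (R1_above d i c d')
  with assms have "i + 1 \<le> length s" by (auto split: if_splits)
  then obtain s1 m s2 where "s = s1 @ m @ s2" "length s1 = i" "length m = 1"
    by (rule split_at)
  then obtain z where s: "s = s1 @ z # s2" "i = length s1"
    by (auto simp: length_Suc_conv)
  from R1_above assms have "writhe s x - writhe s y = crossing_sign c d d"
    by (auto simp: s nth_append split: if_splits)
  with R1_above R1_op(1)[of d i c d'] show ?thesis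
    by (intro exI[of _ "kink A c"]) (auto simp: kink_sign)
next
  case (R1_below d i c d')
  with assms have "i + 1 \<le> length s" by (auto split: if_splits)
  then obtain s1 m s2 where "s = s1 @ m @ s2" "length s1 = i" "length m = 1"
    by (rule split_at)
  then obtain z where s: "s = s1 @ z # s2" "i = length s1"
    by (auto simp: length_Suc_conv)
  from R1_below assms have "writhe s x - writhe s y = crossing_sign c (\<not> d) (\<not> d)"
    by (auto simp: s nth_append split: if_splits)
  with R1_below R1_op(2)[of d i c d'] show ?thesis
    by (intro exI[of _ "kink A c"]) (auto simp: kink_sign)
next
  case (R2 c i)
  with assms have "i + 2 \<le> length s" by (auto split: if_splits)
  then obtain s1 m s2 where "s = s1 @ m @ s2" "length s1 = i" "length m = 2"
    by (rule split_at)
  then obtain z1 z2 where s: "s = s1 @ z1 # z2 # s2" "i = length s1"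
    by (auto simp: length_Suc_conv eval_nat_numeral)
  from R2 have "writhe s x = 0"
    by (cases c) (auto simp: s nth_append crossing_sign_def)
  with R2 R2_op[of c i] show ?thesis
    by (intro exI[of _ 1]) auto
next
  case (R3 a c b i)
  with assms have "i + 3 \<le> length s" by (auto split: if_splits)
  then obtain s1 m s2 where "s = s1 @ m @ s2" "length s1 = i" "length m = 3"
    by (rule split_at)
  then obtain z1 z2 z3 where s: "s = s1 @ z1 # z2 # z3 # s2" "i = length s1"
    by (auto simp: length_Suc_conv eval_nat_numeral)
  from R3 have "writhe s x = writhe s y"
    by (auto simp: s nth_append)
  with R3 R3_op[of a c b i] show ?thesis
    by (intro exI[of _ 1]) auto
qed

text \<open>The rest of the diagram acts linearly, so the scalar passes through it; as
  \<open>x\<close> and \<open>y\<close> end in the same state, the signs outside agree. This serves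
  planar isotopy and Reidemeister moves alike.\<close>

lemma off_axis_change_W:
  assumes "off_axis_change P D D'"
    and P: "\<And>x y s t. P x y \<Longrightarrow> run s x = Some t \<Longrightarrow> run s y = Some t \<Longrightarrow>
      \<exists>c. (\<forall>f. word_op x f = (\<lambda>r. c * word_op y f r))
        \<and> c * (- (inverse A ^ 3)) powi (writhe s x - writhe s y) = 1"
  shows "W D = W D'"
  using assms(1)
proof cases
  case (left x y u s t v a R)
  obtain c where c: "\<And>f. word_op x f = (\<lambda>r. c * word_op y f r)"
    "c * (- (inverse A ^ 3)) powi (writhe s x - writhe s y) = 1"
    using P[OF left(3,5,6)] by blast
  have "alpha D = (writhe s x - writhe s y) + alpha D'" "beta D = beta D'"
    using left by (simp_all add: run_append writhe_append[where s = "[]"] writhe_append)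
  then show ?thesis
    using left c(2)
    by (simp add: W_eval c(1) word_op_linear power_int_add del: alpha.simps beta.simps)
next
  case (right x y L a u s t v)
  obtain c where c: "\<And>f. word_op x f = (\<lambda>r. c * word_op y f r)"
    "c * (- (inverse A ^ 3)) powi (writhe s x - writhe s y) = 1"
    using P[OF right(3,5,6)] by blast
  have "alpha D = (writhe s x - writhe s y) + alpha D'" "beta D = beta D'"
    using right by (auto simp: run_append writhe_append split: bind_splits)
  then show ?thesis
    using right c(2)
    by (simp add: W_eval c(1) word_op_linear axis_op_linear power_int_add del: alpha.simps beta.simps)
qed

lemma planar_local_W: "off_axis_change planar_local D D' \<Longrightarrow> W D = W D'"
  by (erule off_axis_change_W) (intro exI[of _ 1], simp add: planar_local_op planar_local_writhe)

lemma off_axis_local_W: "off_axis_change off_axis_local D D' \<Longrightarrow> W D = W D'"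
  by (erule off_axis_change_W) (rule off_axis_local_change)

section \<open>Moves on the axis\<close>

text \<open>For every move on the axis the signs off the axis have the same sum before and after;
  only the signs on the axis may change, and the scalar compensates them. The whole axis is included
  because its factor is not local.\<close>

definition axis_change :: "axis_event list \<Rightarrow> axis_event list \<Rightarrow> bool list \<Rightarrow> ratfun \<Rightarrow>
    bool diagram \<Rightarrow> bool diagram \<Rightarrow> bool" where
  "axis_change a1 a2 s c = (\<lambda>(x, p, y) (x', p', y').
     (\<forall>f. word_op x (axis_op 0 (a1 @ p @ a2) (word_op y f))
       = (\<lambda>r. c * word_op x' (axis_op 0 (a1 @ p' @ a2) (word_op y' f)) r))
     \<and> writhe s x + writhe (the (flow s (x, a1 @ p @ a2, []))) y
       = writhe s x' + writhe (the (flow s (x', a1 @ p' @ a2, []))) y'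
     \<and> c * (- (inverse B ^ 3)) powi (axis_writhe (the (run s x)) (a1 @ p @ a2)
       - axis_writhe (the (run s x')) (a1 @ p' @ a2)) = 1)"

text \<open>The state is cut at the lower edge of the disk; the axis below contributes only the
  fixed \<open>r1\<close> and a fixed sum of signs.\<close>

lemma axis_split:
  assumes "axis_ends a1 + k \<le> length s"
  obtains s1 m s2 r1 where "s = s1 @ m @ s2" "length m = k"
    "length s1 = axis_ends a1" "length r1 = axis_ends a1"
    "\<forall>m b. axis_run (s1 @ m) (a1 @ b) = map_option ((@) r1) (axis_run m b)"
    "\<forall>m b. axis_writhe (s1 @ m) (a1 @ b) = axis_writhe s1 a1 + axis_writhe m b"
proof -
  obtain s1 m s2 where s: "s = s1 @ m @ s2" "length s1 = axis_ends a1" "length m = k"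
    using split_at[OF assms] by blast
  then obtain r1 where "axis_run s1 a1 = Some r1" "length r1 = length s1"
    using axis_run_total by blast
  with s show thesis
    by (intro that[of s1 m s2 r1]) (simp_all add: axis_run_append axis_writhe_append)
qed

lemma step_at:
  assumes "length s1 = i"
  shows "step (s1 @ s2) (Birth d i) = Some (s1 @ d # (\<not> d) # s2)"
    "step (s1 @ z # s2) (Birth d (Suc i)) = Some (s1 @ z # d # (\<not> d) # s2)"
    "step (s1 @ z # z' # s2) (Death d i) = (if z = d \<and> z' = (\<not> d) then Some (s1 @ s2) else None)"
    "step (s1 @ z0 # z # z' # s2) (Death d (Suc i)) =
      (if z = d \<and> z' = (\<not> d) then Some (s1 @ z0 # s2) else None)"
    "step (s1 @ z # z' # s2) (Cross t i) = Some (s1 @ z' # z # s2)"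
    "step (s1 @ z0 # z # z' # s2) (Cross t (Suc i)) = Some (s1 @ z0 # z' # z # s2)"
    "step (s1 @ z0 # z1 # z # z' # s2) (Cross t (Suc (Suc i))) = Some (s1 @ z0 # z1 # z' # z # s2)"
    "event_sign (s1 @ z # z' # s2) (Cross t i) = crossing_sign t z z'"
    "event_sign (s1 @ z0 # z # z' # s2) (Cross t (Suc i)) = crossing_sign t z z'"
    "event_sign (s1 @ z0 # z1 # z # z' # s2) (Cross t (Suc (Suc i))) = crossing_sign t z z'"
  using assms by (auto simp: nth_append)

lemma crossing_sign_opp [simp]: "crossing_sign (opp t) z z' = - crossing_sign t z z'"
  by (cases t) (simp_all add: crossing_sign_def)

lemma crossing_sign_commute: "crossing_sign t z z' = crossing_sign t z' z"
  by (auto simp: crossing_sign_def)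

lemma crossing_sign_Not [simp]: "crossing_sign t (\<not> z) (\<not> z') = crossing_sign t z z'"
  by (simp add: crossing_sign_def)

lemma crossing_sign_Xu: "crossing_sign Xu z z' = - crossing_sign Xo z z'"
  by (simp add: crossing_sign_def)

lemma axis_local_change:
  assumes "axis_local (axis_ends a1) (x, p, y) (x', p', y')"
    and "flow s (x, a1 @ p @ a2, y) = Some t" "flow s (x', a1 @ p' @ a2, y') = Some t"
  shows "\<exists>c. axis_change a1 a2 s c (x, p, y) (x', p', y')"
proof -
  obtain s' where "run s x = Some s'"
    using assms(2) by (auto split: bind_splits)
  note sx = run_fits[OF this]
  obtain s'' where "run s x' = Some s''"
    using assms(3) by (auto split: bind_splits)
  note sx' = run_fits[OF this]
  obtain sa where "axis_run s'' (a1 @ p' @ a2) = Some sa"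
    using assms(3) \<open>run s x' = Some s''\<close> by (auto split: bind_splits)
  note sa = axis_run_length[OF this]
  note eval = step_at axis_change_def crossing_sign_Xu
  let ?i = "axis_ends a1"
  from assms(1) show ?thesis
  proof cases
    case (S1_upper d c d')
    with sx have "?i + 1 \<le> length s" by simp
    then obtain s1 m s2 r1 where m: "s = s1 @ m @ s2" "length m = 1"
      and len: "length s1 = ?i" "length r1 = ?i"
      and ax: "\<forall>m b. axis_run (s1 @ m) (a1 @ b) = map_option ((@) r1) (axis_run m b)"
        "\<forall>m b. axis_writhe (s1 @ m) (a1 @ b) = axis_writhe s1 a1 + axis_writhe m b"
      by (rule axis_split)
    then obtain z1 where s: "s = s1 @ z1 # s2"
      by (auto simp: length_Suc_conv eval_nat_numeral)
    obtain r2 where r2: "axis_run s2 a2 = Some r2"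
      using assms(2) S1_upper len ax by (auto simp: s step_at del: step.simps split: bind_splits)
    have z: "z1 = d"
      using assms(2) S1_upper len ax r2 by (simp add: s step_at del: step.simps split: if_splits)
    show ?thesis
      using S1_upper len ax r2 S1_upper_op[OF refl, of a1 c a2] kink_sign[of B c d] z
      by (intro exI[of _ "kink B c"]) (simp add: eval s del: step.simps event_sign.simps(1))
  next
    case (S1_lower d c d')
    \<comment> \<open>A birth at the bottom of the disk yields only \<open>?i <= length s\<close>;
      the missing strand is supplied by the axis point on the other side of the move.\<close>
    with sx' sa have "?i + 1 \<le> length s" by simp
    then obtain s1 m s2 r1 where m: "s = s1 @ m @ s2" "length m = 1"
      and len: "length s1 = ?i" "length r1 = ?i"
      and ax: "\<forall>m b. axis_run (s1 @ m) (a1 @ b) = map_option ((@) r1) (axis_run m b)"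
        "\<forall>m b. axis_writhe (s1 @ m) (a1 @ b) = axis_writhe s1 a1 + axis_writhe m b"
      by (rule axis_split)
    then obtain z1 where s: "s = s1 @ z1 # s2"
      by (auto simp: length_Suc_conv eval_nat_numeral)
    obtain r2 where r2: "axis_run s2 a2 = Some r2"
      using assms(2) S1_lower len ax by (auto simp: s step_at del: step.simps split: bind_splits)
    have z: "z1 = (\<not> d)"
      using assms(2) S1_lower len ax r2 by (simp add: s step_at del: step.simps split: if_splits)
    show ?thesis
      using S1_lower len ax r2 S1_lower_op[OF refl, of a1 c a2] kink_sign[of B c "\<not> d"] z
      by (intro exI[of _ "kink B c"]) (simp add: eval s del: step.simps event_sign.simps(1))
  next
    case (S2v d c d' e e')
    with sx' have "?i + 2 \<le> length s" by simp
    then obtain s1 m s2 r1 where m: "s = s1 @ m @ s2" "length m = 2"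
      and len: "length s1 = ?i" "length r1 = ?i"
      and ax: "\<forall>m b. axis_run (s1 @ m) (a1 @ b) = map_option ((@) r1) (axis_run m b)"
        "\<forall>m b. axis_writhe (s1 @ m) (a1 @ b) = axis_writhe s1 a1 + axis_writhe m b"
      by (rule axis_split)
    then obtain z1 z2 where s: "s = s1 @ z1 # z2 # s2"
      by (auto simp: length_Suc_conv eval_nat_numeral)
    obtain r2 where r2: "axis_run s2 a2 = Some r2"
      using assms(2) S2v len ax by (auto simp: s step_at del: step.simps split: bind_splits)
    have z: "z1 = e" "z2 = (\<not> e)"
      using assms(3) S2v len ax r2 by (simp_all add: s step_at del: step.simps split: if_splits)
    \<comment> \<open>The lower crossing joins strands of directions \<open>e\<close> and
      \<open>d\<close>, the upper one strands of directions \<open>\<not> d\<close> and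
      \<open>\<not> e\<close>; as their types are opposite, the signs cancel.\<close>
    show ?thesis
      using S2v len ax r2 S2v_op[OF refl, of a1 c a2] z
      by (intro exI[of _ 1]) (simp add: eval s crossing_sign_commute[of c e d] del: step.simps event_sign.simps(1))
  next
    case (S2h c)
    with sx have "?i + 2 \<le> length s" by simp
    then obtain s1 m s2 r1 where m: "s = s1 @ m @ s2" "length m = 2"
      and len: "length s1 = ?i" "length r1 = ?i"
      and ax: "\<forall>m b. axis_run (s1 @ m) (a1 @ b) = map_option ((@) r1) (axis_run m b)"
        "\<forall>m b. axis_writhe (s1 @ m) (a1 @ b) = axis_writhe s1 a1 + axis_writhe m b"
      by (rule axis_split)
    then obtain z1 z2 where s: "s = s1 @ z1 # z2 # s2"
      by (auto simp: length_Suc_conv eval_nat_numeral)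
    obtain r2 where r2: "axis_run s2 a2 = Some r2"
      using assms(2) S2h len ax by (auto simp: s step_at del: step.simps split: bind_splits)
    show ?thesis
      using S2h len ax r2 S2h_op[OF refl, of c a1 a2]
      by (intro exI[of _ 1]) (simp add: eval s crossing_sign_commute[of c z2 z1] del: step.simps event_sign.simps(1))
  next
    case (S2pm c e)
    with sx have "?i + 2 \<le> length s" by simp
    then obtain s1 m s2 r1 where m: "s = s1 @ m @ s2" "length m = 2"
      and len: "length s1 = ?i" "length r1 = ?i"
      and ax: "\<forall>m b. axis_run (s1 @ m) (a1 @ b) = map_option ((@) r1) (axis_run m b)"
        "\<forall>m b. axis_writhe (s1 @ m) (a1 @ b) = axis_writhe s1 a1 + axis_writhe m b"
      by (rule axis_split)
    then obtain z1 z2 where s: "s = s1 @ z1 # z2 # s2"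
      by (auto simp: length_Suc_conv eval_nat_numeral)
    obtain r2 where r2: "axis_run s2 a2 = Some r2"
      using assms(2) S2pm len ax by (auto simp: s step_at del: step.simps split: bind_splits)
    show ?thesis
      using S2pm len ax r2 S2pm_op[OF refl, of c a1 e a2]
      by (intro exI[of _ 1]) (simp add: eval s crossing_sign_commute[of _ z2 z1] del: step.simps event_sign.simps(1))
  next
    case (S3 c e)
    with sx have "?i + 3 \<le> length s" by simp
    then obtain s1 m s2 r1 where m: "s = s1 @ m @ s2" "length m = 3"
      and len: "length s1 = ?i" "length r1 = ?i"
      and ax: "\<forall>m b. axis_run (s1 @ m) (a1 @ b) = map_option ((@) r1) (axis_run m b)"
        "\<forall>m b. axis_writhe (s1 @ m) (a1 @ b) = axis_writhe s1 a1 + axis_writhe m b"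
      by (rule axis_split)
    then obtain z1 z2 z3 where s: "s = s1 @ z1 # z2 # z3 # s2"
      by (auto simp: length_Suc_conv eval_nat_numeral)
    obtain r2 where r2: "axis_run s2 a2 = Some r2"
      using assms(2) S3 len ax by (auto simp: s step_at del: step.simps split: bind_splits)
    show ?thesis
      using S3 len ax r2 S3_op[OF refl, of c a1 e a2]
      by (intro exI[of _ 1]) (simp add: eval s crossing_sign_commute[of _ z2 z1] crossing_sign_commute[of _ z3 z1] crossing_sign_commute[of _ z3 z2] del: step.simps event_sign.simps(1))
  next
    case (S4_steep e c)
    with sx' have "?i + 4 \<le> length s" by simp
    then obtain s1 m s2 r1 where m: "s = s1 @ m @ s2" "length m = 4"
      and len: "length s1 = ?i" "length r1 = ?i"
      and ax: "\<forall>m b. axis_run (s1 @ m) (a1 @ b) = map_option ((@) r1) (axis_run m b)"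
        "\<forall>m b. axis_writhe (s1 @ m) (a1 @ b) = axis_writhe s1 a1 + axis_writhe m b"
      by (rule axis_split)
    then obtain z1 z2 z3 z4 where s: "s = s1 @ z1 # z2 # z3 # z4 # s2"
      by (auto simp: length_Suc_conv eval_nat_numeral)
    obtain r2 where r2: "axis_run s2 a2 = Some r2"
      using assms(2) S4_steep len ax by (auto simp: s step_at del: step.simps split: bind_splits)
    show ?thesis
      using S4_steep len ax r2 S4_op[OF refl, of Xu a1 e c a2]
      by (intro exI[of _ 1]) (simp add: eval s crossing_sign_commute[of _ z2 z1] crossing_sign_commute[of _ z3 z1] crossing_sign_commute[of _ z3 z2] crossing_sign_commute[of _ z4 z1] crossing_sign_commute[of _ z4 z2] crossing_sign_commute[of _ z4 z3] del: step.simps event_sign.simps(1))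
  next
    case (S4_flat e c)
    with sx have "?i + 4 \<le> length s" by simp
    then obtain s1 m s2 r1 where m: "s = s1 @ m @ s2" "length m = 4"
      and len: "length s1 = ?i" "length r1 = ?i"
      and ax: "\<forall>m b. axis_run (s1 @ m) (a1 @ b) = map_option ((@) r1) (axis_run m b)"
        "\<forall>m b. axis_writhe (s1 @ m) (a1 @ b) = axis_writhe s1 a1 + axis_writhe m b"
      by (rule axis_split)
    then obtain z1 z2 z3 z4 where s: "s = s1 @ z1 # z2 # z3 # z4 # s2"
      by (auto simp: length_Suc_conv eval_nat_numeral)
    obtain r2 where r2: "axis_run s2 a2 = Some r2"
      using assms(2) S4_flat len ax by (auto simp: s step_at del: step.simps split: bind_splits)
    show ?thesis
      using S4_flat len ax r2 S4_op[OF refl, of Xo a1 c e a2]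
      by (intro exI[of _ 1]) (simp add: eval s crossing_sign_commute[of _ z2 z1] crossing_sign_commute[of _ z3 z1] crossing_sign_commute[of _ z3 z2] crossing_sign_commute[of _ z4 z1] crossing_sign_commute[of _ z4 z2] crossing_sign_commute[of _ z4 z3] del: step.simps event_sign.simps(1))
  qed
qed

lemma on_axis_W:
  assumes "axis_local (axis_ends a1) (x, p, y) (x', p', y')" "run [] u = Some s"
    "flow s (x, a1 @ p @ a2, y) = Some t" "flow s (x', a1 @ p' @ a2, y') = Some t"
    "oriented_diagram (u @ x, a1 @ p @ a2, y @ v)"
    "oriented_diagram (u @ x', a1 @ p' @ a2, y' @ v)"
  shows "W (u @ x, a1 @ p @ a2, y @ v) = W (u @ x', a1 @ p' @ a2, y' @ v)"
proof -
  let ?D = "(u @ x, a1 @ p @ a2, y @ v)" and ?D' = "(u @ x', a1 @ p' @ a2, y' @ v)"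
  let ?a = "a1 @ p @ a2" and ?a' = "a1 @ p' @ a2"
  from axis_local_change[OF assms(1,3,4)] obtain c where c:
    "\<And>f. word_op x (axis_op 0 ?a (word_op y f)) = (\<lambda>r. c * word_op x' (axis_op 0 ?a' (word_op y' f)) r)"
    "writhe s x + writhe (the (flow s (x, ?a, []))) y
       = writhe s x' + writhe (the (flow s (x', ?a', []))) y'"
    "c * (- (inverse B ^ 3)) powi (axis_writhe (the (run s x)) ?a - axis_writhe (the (run s x')) ?a') = 1"
    by (auto simp: axis_change_def)
  have "alpha ?D = alpha ?D'"
    using assms(2-4) c(2) by (auto simp: run_append writhe_append split: bind_splits)
  moreover have "beta ?D = (axis_writhe (the (run s x)) ?a - axis_writhe (the (run s x')) ?a') + beta ?D'"
    using assms(2) by (simp add: run_append)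
  ultimately show ?thesis
    using c(3)
    by (simp add: W_eval[OF assms(5)] W_eval[OF assms(6)] c(1) word_op_linear power_int_add
        del: alpha.simps beta.simps)
qed

lemma reidemeister_W: "reidemeister D D' \<Longrightarrow> W D = W D'"
proof (induction rule: reidemeister.induct)
  case (off_axis D D')
  then show ?case by (rule off_axis_local_W)
next
  case (on_axis a1 x p y x' p' y' u s a2 t v)
  then show ?case by (intro on_axis_W)
next
  case (inverse D D')
  then show ?case by simp
qed

section \<open>Rotation of words\<close>

fun rotate_event :: "nat \<Rightarrow> 'd event \<Rightarrow> 'd event" where
  "rotate_event n (Birth d i) = Death d (n - i)"
| "rotate_event n (Death d i) = Birth d (n - 2 - i)"
| "rotate_event n (Cross t i) = Cross t (n - 2 - i)"

lemma Suc_Suc_diff_2: "2 \<le> n \<Longrightarrow> Suc (Suc (n - 2)) = n"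
  by simp

lemma rotate_word_Cons:
  "position e + ends_left e \<le> n \<Longrightarrow> rotate_word n (e # w) =
    rotate_word (n - ends_left e + ends_right e) w @ [rotate_event n e]"
  by (cases e) (auto simp: Suc_Suc_diff_2)

lemma rotate_word_append:
  "fits n u \<Longrightarrow> rotate_word n (u @ v) = rotate_word (width n u) v @ rotate_word n u"
proof (induction u arbitrary: n)
  case (Cons e u)
  from Cons.prems have "position e + ends_left e \<le> n" "fits (n - ends_left e + ends_right e) u"
    by (simp_all only: fits.simps)
  from this(1) Cons.IH[OF this(2)] show ?case
    unfolding append_Cons width.simps by (simp only: rotate_word_Cons append_assoc)
qed simp

lemma length_rotate_word [simp]: "length (rotate_word n w) = length w"
  by (induction n w rule: rotate_word.induct) simp_all

lemma rotate_word_map: "rotate_word n (map (map_event h) w) = map (map_event h) (rotate_word n w)"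
  by (induction n w rule: rotate_word.induct) simp_all

lemma rotate_word_fits:
  "fits n w \<Longrightarrow> fits (width n w) (rotate_word n w) \<and> width (width n w) (rotate_word n w) = n"
proof (induction w arbitrary: n)
  case (Cons e w)
  then show ?case
    by (cases e) (auto simp: rotate_word_Cons Suc_Suc_diff_2)
qed simp

lemma rotate_rotate_word: "fits n w \<Longrightarrow> rotate_word (width n w) (rotate_word n w) = w"
proof (induction w arbitrary: n)
  case (Cons e w)
  let ?n = "n - ends_left e + ends_right e"
  have f: "fits ?n w" "position e + ends_left e \<le> n"
    using Cons.prems by (simp_all only: fits.simps)
  have "rotate_word ?n [rotate_event n e] = [e]"
    using f(2) by (cases e) auto
  with f Cons.IH[OF f(1)] rotate_word_fits[OF f(1)] show ?case
    by (simp add: rotate_word_Cons[OF f(2)] rotate_word_append)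
qed simp

text \<open>A half turn reverses the order of the strands over an abscissa and also the direction of
  each.\<close>

definition rotate_state :: "bool list \<Rightarrow> bool list" where
  "rotate_state s = map Not (rev s)"

lemma rotate_state_simps [simp]:
  "rotate_state [] = []"
  "rotate_state (s @ s') = rotate_state s' @ rotate_state s"
  "rotate_state (z # s) = rotate_state s @ [\<not> z]"
  "length (rotate_state s) = length s"
  by (simp_all add: rotate_state_def)

lemma rotate_step:
  assumes "step s e = Some s'"
  shows "step (rotate_state s') (rotate_event (length s) e) = Some (rotate_state s)
    \<and> event_sign (rotate_state s') (rotate_event (length s) e) = event_sign s e"
proof -
  obtain s1 m s2 where s: "s = s1 @ m @ s2" "length s1 = position e" "length m = ends_left e"
    using step_fits[OF assms] split_at[of "position e" "ends_left e" s] by blast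
  show ?thesis
  proof (cases e)
    case (Birth d i)
    with s assms show ?thesis
      by (auto simp: step_at simp del: step.simps)
  next
    case (Death d i)
    with s obtain z z' where "m = [z, z']" by (auto simp: length_Suc_conv eval_nat_numeral)
    with Death s assms show ?thesis
      by (auto simp: step_at simp del: step.simps split: if_splits)
  next
    case (Cross t i)
    with s obtain z z' where "m = [z, z']" by (auto simp: length_Suc_conv eval_nat_numeral)
    with Cross s assms show ?thesis
      by (auto simp: step_at crossing_sign_commute simp del: step.simps event_sign.simps(1))
  qed
qed

lemma rotate_run:
  "run s w = Some t \<Longrightarrow> run (rotate_state t) (rotate_word (length s) w) = Some (rotate_state s)
    \<and> writhe (rotate_state t) (rotate_word (length s) w) = writhe s w"
proof (induction w arbitrary: s)
  case (Cons e w)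
  then obtain s' where s': "step s e = Some s'" "run s' w = Some t"
    by (auto split: bind_splits)
  with Cons.IH[of s'] step_fits[of s e s'] rotate_step[of s e s'] show ?case
    by (simp add: rotate_word_Cons run_append writhe_append)
qed simp

lemma rotate_axis_run:
  "axis_run s a = Some t \<Longrightarrow> axis_run (rotate_state t) (rev a) = Some (rotate_state s)
    \<and> axis_writhe (rotate_state t) (rev a) = axis_writhe s a"
  by (induction s a arbitrary: t rule: axis_run.induct)
    (auto simp: axis_run_append axis_writhe_append crossing_sign_commute)

lemma axis_ends_rev [simp]: "axis_ends (rev a) = axis_ends a"
  by (induction a rule: axis_ends.induct) simp_all

section \<open>Circles of a rotated word\<close>

definition rotate_point :: "'d event list \<Rightarrow> nat \<times> nat \<Rightarrow> nat \<times> nat" where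
  "rotate_point w = (\<lambda>(t, i). (length w - t, width 0 (take t w) - 1 - i))"

context
  fixes w :: "'d event list"
  assumes w: "fits 0 w" "width 0 w = 0"
begin

lemma width_take_rotate:
  assumes "t \<le> length w"
  shows "width 0 (take (length w - t) (rotate_word 0 w)) = width 0 (take t w)"
proof -
  have f: "fits 0 (take t w @ drop t w)" using w by (simp only: append_take_drop_id)
  then have f1: "fits 0 (take t w)" "fits (width 0 (take t w)) (drop t w)"
    by (simp_all only: fits_append)
  have "width (width 0 (take t w)) (drop t w) = 0"
    using w by (simp only: width_append[symmetric] append_take_drop_id)
  with f1 rotate_word_fits[OF f1(2)] rotate_word_append[OF f1(1), of "drop t w"] show ?thesis
    by simp
qed

lemma rotate_word_nth:
  assumes "t < length w"
  shows "rotate_word 0 w ! (length w - Suc t) = rotate_event (width 0 (take t w)) (w ! t)"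
    "position (w ! t) + ends_left (w ! t) \<le> width 0 (take t w)"
    "width 0 (take (Suc t) w) = width 0 (take t w) - ends_left (w ! t) + ends_right (w ! t)"
proof -
  have e: "w = take t w @ w ! t # drop (Suc t) w"
    using assms by (rule id_take_nth_drop)
  have f: "fits 0 (take t w @ w ! t # drop (Suc t) w)" using w(1) e by simp
  then show le: "position (w ! t) + ends_left (w ! t) \<le> width 0 (take t w)"
    by simp
  have "rotate_word 0 (take t w @ w ! t # drop (Suc t) w) =
    (rotate_word (width 0 (take t w) - ends_left (w ! t) + ends_right (w ! t)) (drop (Suc t) w)
     @ [rotate_event (width 0 (take t w)) (w ! t)]) @ rotate_word 0 (take t w)"
    using f le by (simp add: rotate_word_append rotate_word_Cons)
  with e show "rotate_word 0 w ! (length w - Suc t) = rotate_event (width 0 (take t w)) (w ! t)"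
    by (simp add: nth_append)
  show "width 0 (take (Suc t) w) = width 0 (take t w) - ends_left (w ! t) + ends_right (w ! t)"
    using assms by (simp add: take_Suc_conv_app_nth)
qed

text \<open>Births and deaths are exchanged and both coordinates reversed, so each elementary join
  becomes one in the opposite direction.\<close>

lemma rotate_joined:
  assumes "joined w p q"
  shows "joined (rotate_word 0 w) (rotate_point w q) (rotate_point w p)"
  using assms
proof cases
  case (strand t i j)
  let ?n = "width 0 (take t w)" and ?n' = "width 0 (take (Suc t) w)"
  note nth = rotate_word_nth[OF strand(3)]
  have "j < ?n'" "carry (rotate_event ?n (w ! t)) (?n' - 1 - j) = Some (?n - 1 - i)"
    using strand(4,5) nth(2,3) by (cases "w ! t"; auto split: if_splits)+
  then have "joined (rotate_word 0 w) (length w - Suc t, ?n' - 1 - j)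
      (Suc (length w - Suc t), ?n - 1 - i)"
    using strand(3) nth(1) width_take_rotate[of "Suc t"] by (intro joined.strand) auto
  with strand show ?thesis by (simp add: rotate_point_def Suc_diff_Suc)
next
  case (birth t d i)
  let ?n = "width 0 (take t w)"
  note nth = rotate_word_nth[OF birth(3)]
  have "joined (rotate_word 0 w) (length w - Suc t, ?n - i) (length w - Suc t, ?n - i + 1)"
    using birth nth(1) by (intro joined.death) auto
  with birth nth show ?thesis by (simp add: rotate_point_def Suc_diff_le)
next
  case (death t d i)
  let ?n = "width 0 (take t w)"
  note nth = rotate_word_nth[OF death(3)]
  have "joined (rotate_word 0 w) (Suc (length w - Suc t), ?n - 2 - i)
      (Suc (length w - Suc t), ?n - 2 - i + 1)"
    using death nth(1) by (intro joined.birth) auto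
  moreover have "?n - 2 - i + 1 = ?n - 1 - i" "?n - 2 - i = ?n - 1 - (i + 1)"
    using death nth(2) by auto
  ultimately show ?thesis using death by (simp add: rotate_point_def Suc_diff_Suc)
qed

lemma rotate_equivclp:
  "equivclp (joined w) p q \<Longrightarrow>
    equivclp (joined (rotate_word 0 w)) (rotate_point w p) (rotate_point w q)"
  by (induction rule: equivclp_induct) (auto intro: equivclp_into_equivclp dest: rotate_joined)

lemma rotate_point_points: "p \<in> points w \<Longrightarrow> rotate_point w p \<in> points (rotate_word 0 w)"
  using width_take_rotate by (auto simp: points_def rotate_point_def)

lemma rotate_rotate_point:
  "p \<in> points w \<Longrightarrow> rotate_point (rotate_word 0 w) (rotate_point w p) = p"
  using width_take_rotate by (auto simp: points_def rotate_point_def)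

end

text \<open>The components of the rotated word, pulled back along \<open>rotate_point\<close>, label
  the points of \<open>w\<close>. That distinct components stay distinct follows by rotating once
  more.\<close>

lemma circles_rotate:
  assumes w: "fits 0 w" "width 0 w = 0"
  shows "circles (rotate_word 0 w) = circles w"
proof -
  let ?w = "rotate_word 0 w"
  have w': "fits 0 ?w" "width 0 ?w = 0" and ww: "rotate_word 0 ?w = w"
    using rotate_word_fits[OF w(1)] rotate_rotate_word[OF w(1)] w(2) by simp_all
  define l where "l p = {q. equivclp (joined ?w) p q}" for p
  have l: "l p = l q \<longleftrightarrow> equivclp (joined ?w) p q" for p q
  proof -
    have "equiv UNIV {(p, q). equivclp (joined ?w) p q}"
      by (simp add: equivp_equiv)
    from eq_equiv_class_iff[OF this UNIV_I UNIV_I, of p q] show ?thesis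
      by (simp add: l_def Image_def)
  qed
  have "circles ?w = card (l ` points ?w)"
    by (rule circles_eq_card_labels) (auto simp: l)
  moreover have "circles w = card ((\<lambda>p. l (rotate_point w p)) ` points w)"
  proof (rule circles_eq_card_labels)
    fix p q assume "joined w p q"
    then show "l (rotate_point w p) = l (rotate_point w q)"
      using rotate_equivclp[OF w] by (simp add: l r_into_equivclp)
  next
    fix p q assume "p \<in> points w" "q \<in> points w" "l (rotate_point w p) = l (rotate_point w q)"
    then show "equivclp (joined w) p q"
      using rotate_equivclp[OF w', of "rotate_point w p" "rotate_point w q"]
      by (simp add: l ww rotate_rotate_point[OF w])
  qed
  moreover have "points ?w = rotate_point w ` points w"
  proof (intro set_eqI iffI)
    fix p assume p: "p \<in> points ?w"
    from rotate_point_points[OF w' p] rotate_rotate_point[OF w' p]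
    show "p \<in> rotate_point w ` points w"
      by (metis ww imageI)
  qed (use rotate_point_points[OF w] in blast)
  ultimately show ?thesis by (simp add: image_image)
qed

section \<open>The bracket of a rotated diagram\<close>

definition diagram_eval :: "unit diagram \<Rightarrow> ratfun" where
  "diagram_eval = (\<lambda>(L, a, R). word_op L (axis_op 0 a (word_op R (\<lambda>_. 1))) unlinked)"

fun crossings :: "unit diagram \<Rightarrow> nat" where
  "crossings (L, a, R) = length (filter (\<lambda>e. \<exists>t i. e = Cross t i) (L @ R))
     + length (filter (\<lambda>e. e \<noteq> AxisPoint) a)"

lemma diagram_eval_left:
  "diagram_eval (u @ Cross t i # v, a, R) = coeff_h A t * diagram_eval (u @ v, a, R)
    + coeff_v A t * diagram_eval (u @ [Death () i, Birth () i] @ v, a, R)"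
  by (simp add: diagram_eval_def cross_op_def word_op_linear)

lemma diagram_eval_right:
  "diagram_eval (L, a, u @ Cross t i # v) = coeff_h A t * diagram_eval (L, a, u @ v)
    + coeff_v A t * diagram_eval (L, a, u @ [Death () i, Birth () i] @ v)"
  by (simp add: diagram_eval_def cross_op_def word_op_linear axis_op_linear)

lemma diagram_eval_axis:
  "diagram_eval (L, a @ AxisCross t # b, R) =
    coeff_h B t * diagram_eval (L, a @ [AxisPoint, AxisPoint] @ b, R)
    + coeff_v B t * diagram_eval
        (L @ [Death () (axis_ends a)], a @ b, [Birth () (axis_ends a)] @ R)"
  by (simp add: diagram_eval_def axis_op_skein word_op_linear)

lemma axis_op_replicate: "axis_op p (replicate k AxisPoint) f = (\<lambda>r. (loop_B / loop_A) ^ ((p + k) div 2) * f r)"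
  by (induction k arbitrary: p) simp_all

text \<open>A half turn preserves the type of a crossing and both of its smoothings, so each skein
  relation goes over into one for the rotated diagram. Smoothing lowers the number of crossings, and
  without crossings only circles and axis points are counted.\<close>

lemma diagram_eval_rotate:
  "diagram_fits D \<Longrightarrow> diagram_eval (rotate_diagram D) = diagram_eval D"
proof (induction "crossings D" arbitrary: D rule: less_induct)
  case less
  obtain L a R where D: "D = (L, a, R)" by (cases D)
  consider u t i v where "L = u @ Cross t i # v" | u t i v where "R = u @ Cross t i # v"
    | b t c where "a = b @ AxisCross t # c"
    | "crossingless L" "crossingless R" "\<forall>t. AxisCross t \<notin> set a"
    unfolding crossingless_def by (meson split_list)
  then show ?case
  proof cases
    case (1 u t i v)
    let ?n = "width 0 u"
    let ?D1 = "(u @ v, a, R)" and ?D2 = "(u @ [Death () i, Birth () i] @ v, a, R)"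
    have f: "fits 0 u" "i + 2 \<le> ?n" and n: "Suc (Suc (?n - 2)) = ?n"
      and fits: "diagram_fits ?D1" "diagram_fits ?D2"
      using less.prems by (auto simp: D 1 diagram_fits_def Suc_Suc_diff_2)
    have "diagram_eval (rotate_diagram ?D1) = diagram_eval ?D1"
      "diagram_eval (rotate_diagram ?D2) = diagram_eval ?D2"
      by (rule less.hyps[OF _ fits(1)] less.hyps[OF _ fits(2)]; simp add: D 1)+
    then show ?thesis
      using f by (simp add: D 1 diagram_eval_left diagram_eval_right rotate_word_append n)
  next
    case (2 u t i v)
    let ?n = "width (axis_ends a) u"
    let ?D1 = "(L, a, u @ v)" and ?D2 = "(L, a, u @ [Death () i, Birth () i] @ v)"
    have f: "fits (axis_ends a) u" "i + 2 \<le> ?n" and n: "Suc (Suc (?n - 2)) = ?n"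
      and fits: "diagram_fits ?D1" "diagram_fits ?D2"
      using less.prems by (auto simp: D 2 diagram_fits_def Suc_Suc_diff_2)
    have "diagram_eval (rotate_diagram ?D1) = diagram_eval ?D1"
      "diagram_eval (rotate_diagram ?D2) = diagram_eval ?D2"
      by (rule less.hyps[OF _ fits(1)] less.hyps[OF _ fits(2)]; simp add: D 2)+
    then show ?thesis
      using f by (simp add: D 2 diagram_eval_left diagram_eval_right rotate_word_append n)
  next
    case (3 b t c)
    let ?D1 = "(L, b @ [AxisPoint, AxisPoint] @ c, R)"
      and ?D2 = "(L @ [Death () (axis_ends b)], b @ c, [Birth () (axis_ends b)] @ R)"
    have fits: "diagram_fits ?D1" "diagram_fits ?D2"
      and L: "fits 0 L" "width 0 L = axis_ends b + axis_ends c + 2"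
      using less.prems by (auto simp: D 3 diagram_fits_def)
    have "diagram_eval (rotate_diagram ?D1) = diagram_eval ?D1"
      "diagram_eval (rotate_diagram ?D2) = diagram_eval ?D2"
      by (rule less.hyps[OF _ fits(1)] less.hyps[OF _ fits(2)]; simp add: D 3)+
    then show ?thesis
      using L by (simp add: D 3 diagram_eval_axis rotate_word_append)
  next
    case 4
    have a: "a = replicate (length a) AxisPoint"
      using 4(3) by (intro replicate_eqI) (auto, metis axis_event.exhaust)
    then obtain p where p: "a = replicate p AxisPoint" by blast
    have ends: "axis_ends (replicate p AxisPoint) = p"
      by (induction p) simp_all
    from less.prems have f: "fits 0 (L @ R)" "width 0 (L @ R) = 0" and L: "fits 0 L" "width 0 L = p"
      by (auto simp: D diagram_fits_def p ends)
    have cr: "crossingless (rotate_word n w)" if "crossingless w" for n and w :: "unit event list"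
      using that by (induction n w rule: rotate_word.induct) auto
    have rot: "rotate_word 0 (L @ R) = rotate_word p R @ rotate_word 0 L"
      using L by (simp add: rotate_word_append)
    have eval: "word_op w (\<lambda>_. 1) unlinked = loop_A ^ circles w"
      if "crossingless w" "fits 0 w" "width 0 w = 0" for w :: "unit event list"
      using that by (simp add: word_op_crossingless circles_eq_loops)
    \<comment> \<open>Without axis crossings the axis is a scalar, and the two half planes form the
      single closed word \<open>L @ R\<close>.\<close>
    have "word_op (rotate_word 0 (L @ R)) (\<lambda>_. 1) unlinked = word_op (L @ R) (\<lambda>_. 1) unlinked"
      using f 4 cr rotate_word_fits[OF f(1)] by (simp add: eval circles_rotate del: word_op_simps)
    then show ?thesis
      unfolding rot by (simp add: D p ends diagram_eval_def axis_op_replicate word_op_linear)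
  qed
qed

lemma W_rotate:
  assumes "oriented_diagram D"
  shows "W (rotate_diagram D) = W D"
proof -
  obtain L a R where D: "D = (L, a, R)" by (cases D)
  from assms obtain s t where run: "run [] L = Some s" "axis_run s a = Some t" "run t R = Some []"
    unfolding D by (rule oriented_diagramE)
  note rot = rotate_run[OF run(1)] rotate_axis_run[OF run(2)] rotate_run[OF run(3)]
  have n: "length t = axis_ends a"
    using axis_run_length[OF run(2)] by simp
  have or: "oriented_diagram (rotate_diagram D)"
    using rot n by (simp add: D oriented_diagram_def)
  have fits: "diagram_fits (forget_orientation D)"
    using oriented_diagram_fits[OF assms] by (simp add: D diagram_fits_def)
  have "alpha (rotate_diagram D) = alpha D" "beta (rotate_diagram D) = beta D"
    using rot run n by (simp_all add: D)
  moreover have "word_op (rotate_word (axis_ends a) R) (axis_op 0 (rev a) (word_op (rotate_word 0 L) (\<lambda>_. 1))) unlinked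
    = word_op L (axis_op 0 a (word_op R (\<lambda>_. 1))) unlinked"
    using diagram_eval_rotate[OF fits] by (simp add: D diagram_eval_def rotate_word_map)
  ultimately show ?thesis
    using or assms by (simp add: D W_eval del: alpha.simps beta.simps)
qed

lemma isotopic_W: "isotopic D D' \<Longrightarrow> W D = W D'"
proof -
  have step: "W E = W E'" if "isotopy_step E E'" for E E'
    using that by cases (simp_all add: planar_local_W W_rotate)
  assume "isotopic D D'"
  then show "W D = W D'"
    unfolding isotopic_def by (induction rule: equivclp_induct) (auto dest: step)
qed

theorem theorem1p5:
  fixes D D' :: "bool diagram"
  assumes "oriented_diagram D" and "oriented_diagram D'"
  shows "(isotopic D D' \<longrightarrow> W D = W D') \<and> (reidemeister D D' \<longrightarrow> W D = W D')"
  using isotopic_W reidemeister_W by blast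

end
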